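(* Consider the linear Gaussian model $\mathbf{Y}=\widetilde{\mathbf{X}}\mathbf{H}+\mathbf{V}$ with the group-sparse parameterized prior on $\mathbf{H}\in\mathbb{C}^{NMR\times K}$ described in the context, with hyperparameters $\bar{\boldsymbol\psi}=(\bar\psi_1,\dots,\bar\psi_{NMR/d})\in(0,\infty)^{NMR/d}$ and $\mathbf{\Psi}_G=\mathrm{diag}[\bar\psi_1,\dots,\bar\psi_{NMR/d}]\otimes\mathbf{I}_d$. Fix an observation $\mathbf{Y}\in\mathbb{C}^{M(L+R-1)\times K}$. Let $l\ge 1$, let the previous estimates $\widehat{\bar\psi}_i^{(l-1)}>0$, $1\le i\le NMR/d$, be given, put $\widehat{\mathbf{\Psi}}_G^{(l-1)}=\mathrm{diag}[\widehat{\bar\psi}_1^{(l-1)},\dots,\widehat{\bar\psi}_{NMR/d}^{(l-1)}]\otimes\mathbf{I}_d$, and define $$\mathbf{\Sigma}_G^{(l)}=\left(\widetilde{\mathbf{X}}^H\mathbf{R}_v^{-1}\widetilde{\mathbf{X}}+\left(\widehat{\mathbf{\Psi}}_G^{(l-1)}\right)^{-1}\right)^{-1}\in\mathbb{C}^{NMR\times NMR},\qquad \boldsymbol{\mathcal{M}}_G^{(l)}=\mathbf{\Sigma}_G^{(l)}\widetilde{\mathbf{X}}^H\mathbf{R}_v^{-1}\mathbf{Y}\in\mathbb{C}^{NMR\times K}.$$ Then the hyperparameters $\widehat{\bar{\boldsymbol\psi}}^{(l)}$ that maximize, over $\bar{\boldsymbol\psi}\in(0,\infty)^{NMR/d}$,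 the EM objective $$\mathbb{E}_{\mathbf{H}|\mathbf{Y};\widehat{\mathbf{\Psi}}_G^{(l-1)}}\left\{\log p\left(\mathbf{Y},\mathbf{H};\mathbf{\Psi}_G\right)\right\}$$ are given, for each $1\le i\le NMR/d$, by $$\widehat{\bar\psi}_i^{(l)}=\frac{1}{dK}\sum_{k=1}^{K}\sum_{j=(i-1)d+1}^{id}\left|\boldsymbol{\mathcal{M}}_G^{(l)}(j,k)\right|^2+\frac1d\sum_{j=(i-1)d+1}^{id}\mathbf{\Sigma}_G^{(l)}(j,j).$$
   Context: $N,M,R,K,L$ are positive integers (numbers of transmit antennas, receive antennas, range bins, pulses, and transmit samples), and $d$ (the group length) is a positive integer dividing $NMR$. For each $n=1,\dots,N$, given complex numbers $x_n[1],\dots,x_n[L]$, $\mathbf{X}_n\in\mathbb{C}^{(L+R-1)\times R}$ is the Toeplitz convolution matrix with $(a,b)$ entry $x_n[a-b+1]$ when $1\le a-b+1\le L$ and $0$ otherwise. $\mathbf{X}=[\mathbf{X}_1,\dots,\mathbf{X}_N]\in\mathbb{C}^{(L+R-1)\times NR}$ and $\widetilde{\mathbf{X}}=\mathbf{I}_M\otimes\mathbf{X}\in\mathbb{C}^{M(L+R-1)\times NMR}$. Observation model: $\mathbf{Y}=\widetilde{\mathbf{X}}\mathbf{H}+\mathbf{V}$, where the columns of $\mathbf{V}\in\mathbb{C}^{M(L+R-1)\times K}$ are independent circularly symmetric complex Gaussian $\mathcal{CN}(\mathbf{0},\mathbf{R}_v)$ vectors with $\mathbf{R}_v$ a (known)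 Hermitian positive definite matrix, independent of $\mathbf{H}$. Thus $p(\mathbf{Y}|\mathbf{H})$ is the corresponding Gaussian density and does not depend on the hyperparameters. Group-sparse prior: the density of $\mathbf{H}$ with respect to Lebesgue measure on $\mathbb{C}^{NMR\times K}$ is $$p(\mathbf{H};\mathbf{\Psi}_G)=\prod_{i=1}^{NMR/d}\prod_{k=1}^{K}(\pi\bar\psi_i)^{-d}\exp\left(-\frac{\sum_{j=(i-1)d+1}^{id}|\mathbf{H}(j,k)|^2}{\bar\psi_i}\right).$$ The joint density is $p(\mathbf{Y},\mathbf{H};\mathbf{\Psi}_G)=p(\mathbf{Y}|\mathbf{H})\,p(\mathbf{H};\mathbf{\Psi}_G)$, and $\mathbb{E}_{\mathbf{H}|\mathbf{Y};\widehat{\mathbf{\Psi}}_G^{(l-1)}}\{\cdot\}$ denotes expectation over $\mathbf{H}$ under its posterior (conditional) distribution given $\mathbf{Y}$ in the model with hyperparameter matrix $\widehat{\mathbf{\Psi}}_G^{(l-1)}$. $\mathbf{\Sigma}_G^{(l)}$ and $\boldsymbol{\mathcal{M}}_G^{(l)}$ are called the posterior covariance and mean matrices. *)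

theory Defs
  imports
    "HOL-Probability.Probability"
    "Jordan_Normal_Form.Gauss_Jordan_Elimination"
    "Jordan_Normal_Form.Determinant"
    "Jordan_Normal_Form.Schur_Decomposition"
begin

hide_const (open) Determinants.det Finite_Cartesian_Product.mat

text \<open>All indices start at 0, as in the matrix library: the sample x_n[s] is \<open>x (n - 1) (s - 1)\<close>,
  and group i consists of the rows \<open>i * d, \<dots>, (i + 1) * d - 1\<close>.\<close>

text \<open>The inverse is only meaningful for invertible matrices.\<close>

definition mat_inv :: "complex mat \<Rightarrow> complex mat" where
  "mat_inv A = the (mat_inverse A)"

definition kronecker :: "complex mat \<Rightarrow> complex mat \<Rightarrow> complex mat" where
  "kronecker A B =
     mat (dim_row A * dim_row B) (dim_col A * dim_col B)
       (\<lambda>(i, j). A $$ (i div dim_row B, j div dim_col B) * B $$ (i mod dim_row B, j mod dim_col B))"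

text \<open>Here \<open>(A *\<^sub>v v) \<bullet>c v\<close> is v^H A v, and \<open>0 < z\<close> for complex z says that z is real and positive.\<close>

definition hermitian_pos_def :: "complex mat \<Rightarrow> bool" where
  "hermitian_pos_def A \<longleftrightarrow>
     square_mat A \<and> mat_adjoint A = A \<and>
     (\<forall>v \<in> carrier_vec (dim_row A). v \<noteq> 0\<^sub>v (dim_row A) \<longrightarrow> 0 < (A *\<^sub>v v) \<bullet>c v)"


definition toeplitz_conv :: "nat \<Rightarrow> nat \<Rightarrow> (nat \<Rightarrow> complex) \<Rightarrow> complex mat" where
  "toeplitz_conv L R s =
     mat (L + R - 1) R (\<lambda>(a, b). if b \<le> a \<and> a - b < L then s (a - b) else 0)"

text \<open>The block row \<open>[X_1, \<dots>, X_N]\<close>, each block having R columns.\<close>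

definition waveform_mat ::
    "nat \<Rightarrow> nat \<Rightarrow> nat \<Rightarrow> (nat \<Rightarrow> nat \<Rightarrow> complex) \<Rightarrow> complex mat" where
  "waveform_mat N L R x =
     mat (L + R - 1) (N * R) (\<lambda>(a, c). toeplitz_conv L R (x (c div R)) $$ (a, c mod R))"

definition mimo_mat ::
    "nat \<Rightarrow> nat \<Rightarrow> nat \<Rightarrow> nat \<Rightarrow> (nat \<Rightarrow> nat \<Rightarrow> complex) \<Rightarrow> complex mat" where
  "mimo_mat N M L R x = kronecker (1\<^sub>m M) (waveform_mat N L R x)"


text \<open>Density of CN(0, C) with respect to Lebesgue measure; the determinant and the quadratic
  form v^H C^{-1} v are real when C is Hermitian positive definite.\<close>

definition cgauss_density :: "complex mat \<Rightarrow> complex vec \<Rightarrow> real" where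
  "cgauss_density C v =
     exp (- Re ((mat_inv C *\<^sub>v v) \<bullet>c v)) / (pi ^ dim_row C * Re (det C))"

text \<open>The density p(Y|H) for Y = A H + V, where the columns of V are i.i.d. CN(0, Rv).\<close>

definition likelihood :: "complex mat \<Rightarrow> complex mat \<Rightarrow> complex mat \<Rightarrow> complex mat \<Rightarrow> real" where
  "likelihood A Rv Y H = (\<Prod>k<dim_col Y. cgauss_density Rv (col (Y - A * H) k))"

definition prior_density :: "nat \<Rightarrow> (nat \<Rightarrow> real) \<Rightarrow> complex mat \<Rightarrow> real" where
  "prior_density d \<psi> H =
     (\<Prod>i<dim_row H div d. \<Prod>k<dim_col H.
        inverse ((pi * \<psi> i) ^ d) * exp (- (\<Sum>j=i*d..<(i+1)*d. (cmod (H $$ (j, k)))\<^sup>2) / \<psi> i))"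

definition joint_density ::
    "complex mat \<Rightarrow> complex mat \<Rightarrow> nat \<Rightarrow> (nat \<Rightarrow> real) \<Rightarrow> complex mat \<Rightarrow> complex mat \<Rightarrow> real" where
  "joint_density A Rv d \<psi> Y H = likelihood A Rv Y H * prior_density d \<psi> H"

text \<open>Lebesgue measure on m by n complex matrices, a matrix being represented by its entry function
  h; the matrix itself is \<open>mat m n h\<close>.\<close>

definition lborel_entries :: "nat \<Rightarrow> nat \<Rightarrow> (nat \<times> nat \<Rightarrow> complex) measure" where
  "lborel_entries m n = Pi\<^sub>M ({..<m} \<times> {..<n}) (\<lambda>_. lborel)"

definition evidence ::
    "complex mat \<Rightarrow> complex mat \<Rightarrow> nat \<Rightarrow> (nat \<Rightarrow> real) \<Rightarrow> complex mat \<Rightarrow> real" where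
  "evidence A Rv d \<psi> Y =
     (\<integral>h. joint_density A Rv d \<psi> Y (mat (dim_col A) (dim_col Y) h)
        \<partial>lborel_entries (dim_col A) (dim_col Y))"

text \<open>The conditional distribution of H given Y, by Bayes' rule.\<close>

definition posterior ::
    "complex mat \<Rightarrow> complex mat \<Rightarrow> nat \<Rightarrow> (nat \<Rightarrow> real) \<Rightarrow> complex mat \<Rightarrow>
     (nat \<times> nat \<Rightarrow> complex) measure" where
  "posterior A Rv d \<psi> Y =
     density (lborel_entries (dim_col A) (dim_col Y))
       (\<lambda>h. ennreal (joint_density A Rv d \<psi> Y (mat (dim_col A) (dim_col Y) h)
                       / evidence A Rv d \<psi> Y))"

definition em_objective ::
    "complex mat \<Rightarrow> complex mat \<Rightarrow> nat \<Rightarrow> complex mat \<Rightarrow> (nat \<Rightarrow> real) \<Rightarrow> (nat \<Rightarrow> real) \<Rightarrow> real" where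
  "em_objective A Rv d Y \<psi>prev \<psi> =
     (\<integral>h. ln (joint_density A Rv d \<psi> Y (mat (dim_col A) (dim_col Y) h))
        \<partial>posterior A Rv d \<psi>prev Y)"


definition hyper_mat :: "nat \<Rightarrow> nat \<Rightarrow> (nat \<Rightarrow> real) \<Rightarrow> complex mat" where
  "hyper_mat g d \<psi> = kronecker (mat_diag g (\<lambda>i. complex_of_real (\<psi> i))) (1\<^sub>m d)"

definition posterior_cov ::
    "complex mat \<Rightarrow> complex mat \<Rightarrow> nat \<Rightarrow> (nat \<Rightarrow> real) \<Rightarrow> complex mat" where
  "posterior_cov A Rv d \<psi> =
     mat_inv (mat_adjoint A * mat_inv Rv * A + mat_inv (hyper_mat (dim_col A div d) d \<psi>))"

definition posterior_mean ::
    "complex mat \<Rightarrow> complex mat \<Rightarrow> nat \<Rightarrow> (nat \<Rightarrow> real) \<Rightarrow> complex mat \<Rightarrow> complex mat" where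
  "posterior_mean A Rv d \<psi> Y = posterior_cov A Rv d \<psi> * mat_adjoint A * mat_inv Rv * Y"

end

theory Submission
  imports Defs
begin

text \<open>Up to a constant, minus the log posterior density is a positive quadratic form in the entries
  of H. Along a single complex coordinate it is a one-dimensional Gaussian, so Fubini's theorem turns
  one-dimensional identities into Stein identities: the expectation of the gradient vanishes and the
  expectation of the gradient times a conjugate coordinate is 0 or 1. They are linear equations that
  determine the posterior mean and covariance without computing any Gaussian normalization constant
  in several dimensions. Then the EM objective is a constant minus a sum over the groups of
  \<open>d K ln (pi psi_i) + T_i / psi_i\<close>, where T_i is the posterior second moment of group i, and each
  summand has its unique minimum at \<open>T_i / (d K)\<close>.\<close>

section \<open>Gaussian integrals over the complex plane\<close>

text \<open>Inverses, quotients, logarithms and Bochner integrals are total functions, so much of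
  the work is to show that each is used where it has its usual meaning. The misfit is nonnegative,
  hence the likelihood is bounded and the Gaussian prior supplies the integrable majorants.
  Invertibility of the precision matrix is a conclusion: the Stein identities exhibit the covariance
  as a right inverse, and for square matrices this is the inverse. The gradient is taken with
  respect to conjugate coordinates because it is then affine in H without conjugates, which makes
  the identities linear in the moments. The identity with value 1 has a second use: it would fail if
  a second moment vanished, and so it keeps T_i / (d K) inside the open domain.\<close>

lemma has_bochner_integral_lborel_complex:
  fixes a b :: "real \<Rightarrow> real"
  assumes a: "has_bochner_integral lborel a x" and b: "has_bochner_integral lborel b y"
  shows "has_bochner_integral lborel (\<lambda>z. a (Re z) * b (Im z)) (x * y)"
proof -
  interpret product_sigma_finite "\<lambda>_::complex. lborel :: real measure" ..
  \<comment> \<open>Lebesgue measure on the plane is the image of the product measure over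
    \<open>Basis\<close>, which consists of 1 and the imaginary unit. F attaches a to the real and b
    to the imaginary coordinate.\<close>
  define F where "F e = (if e = (1::complex) then a else b)" for e
  have F: "integrable lborel (F e)" for e
    using a b by (auto simp: F_def has_bochner_integral_iff)
  have "integrable (\<Pi>\<^sub>M e\<in>Basis. lborel) (\<lambda>f. \<Prod>e\<in>(Basis::complex set). F e (f e))"
    using F by (intro product_integrable_prod) auto
  moreover have "(\<integral>f. (\<Prod>e\<in>(Basis::complex set). F e (f e)) \<partial>(\<Pi>\<^sub>M e\<in>Basis. lborel)) = x * y"
    using F a b
    by (subst product_integral_prod) (auto simp: F_def Basis_complex_def has_bochner_integral_iff)
  moreover have "(\<lambda>z. a (Re z) * b (Im z)) \<in> borel_measurable (borel :: complex measure)"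
    using a b by (auto simp: has_bochner_integral_iff intro!: borel_measurable_times
        measurable_compose[of Re borel borel a] measurable_compose[of Im borel borel b])
  moreover have "(\<lambda>f. \<Sum>e\<in>Basis. f e *\<^sub>R e) \<in> (\<Pi>\<^sub>M e\<in>Basis. lborel) \<rightarrow>\<^sub>M (borel :: complex measure)"
    by measurable
  ultimately show ?thesis
    unfolding has_bochner_integral_iff
    by (subst (1 2) lborel_eq)
       (auto simp: integrable_distr_eq integral_distr F_def Basis_complex_def)
qed

lemma has_bochner_integral_lborel_translate:
  fixes F :: "'a::euclidean_space \<Rightarrow> 'b::{banach, second_countable_topology}"
  assumes "has_bochner_integral lborel F x"
  shows "has_bochner_integral lborel (\<lambda>z. F (t + z)) x"
proof -
  have eq: "distr lborel borel (\<lambda>z. t + z) = (lborel :: 'a measure)"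
    using lborel_affine[of 1 t] by (simp add: density_1)
  have "has_bochner_integral (distr lborel borel (\<lambda>z. t + z)) F x"
    using assms by (simp add: eq)
  then show ?thesis
    by (auto simp: has_bochner_integral_iff integral_distr dest: integrable_distr[rotated])
qed

lemma has_bochner_integral_lborel_reflect:
  fixes F :: "'a::euclidean_space \<Rightarrow> 'b::{banach, second_countable_topology}"
  assumes "has_bochner_integral lborel F x"
  shows "has_bochner_integral lborel (\<lambda>z. F (- z)) x"
proof -
  have eq: "distr lborel borel uminus = (lborel :: 'a measure)"
    using lborel_affine[of "-1" "0::'a"] by (simp add: density_1)
  have "has_bochner_integral (distr lborel borel uminus) F x"
    using assms by (simp add: eq)
  then show ?thesis
    by (auto simp: has_bochner_integral_iff integral_distr dest: integrable_distr[rotated])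
qed

lemma real_gaussian_moments:
  fixes p :: real assumes p: "p > 0"
  shows "has_bochner_integral lborel (\<lambda>x. exp (- (p * x\<^sup>2))) (sqrt (pi / p))"
    and "has_bochner_integral lborel (\<lambda>x. x\<^sup>2 * exp (- (p * x\<^sup>2))) (sqrt (pi / p) / (2 * p))"
proof -
  \<comment> \<open>The standard deviation at which \<open>exp (- (p * x\<^sup>2))\<close> is a
    multiple of the centred normal density.\<close>
  define \<sigma> where "\<sigma> = sqrt (1 / (2 * p))"
  have \<sigma>: "\<sigma> > 0" "\<sigma>\<^sup>2 = 1 / (2 * p)" using p by (auto simp: \<sigma>_def)
  have d: "exp (- (p * x\<^sup>2)) = normal_density 0 \<sigma> x * sqrt (pi / p)" for x
    using p \<sigma>(1) unfolding normal_density_def by (simp add: \<sigma>(2) field_simps real_sqrt_divide)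
  from has_bochner_integral_mult_left[OF normal_moment_even[OF \<sigma>(1), of 0 0], of "sqrt (pi / p)"]
  show "has_bochner_integral lborel (\<lambda>x. exp (- (p * x\<^sup>2))) (sqrt (pi / p))"
    by (simp add: d)
  from has_bochner_integral_mult_left[OF normal_moment_even[OF \<sigma>(1), of 0 1], of "sqrt (pi / p)"]
  show "has_bochner_integral lborel (\<lambda>x. x\<^sup>2 * exp (- (p * x\<^sup>2))) (sqrt (pi / p) / (2 * p))"
    using p by (simp add: d \<sigma>(2) fact_numeral mult_ac)
qed

lemma complex_gaussian_moments:
  fixes p :: real assumes p: "p > 0"
  shows "has_bochner_integral lborel (\<lambda>z. exp (- (p * (cmod z)\<^sup>2))) (pi / p)"
    and "has_bochner_integral lborel (\<lambda>z. (cmod z)\<^sup>2 * exp (- (p * (cmod z)\<^sup>2))) (pi / p\<^sup>2)"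
    and "has_bochner_integral lborel (\<lambda>z. z * of_real (exp (- (p * (cmod z)\<^sup>2)))) 0"
proof -
  have s: "sqrt (pi / p) * sqrt (pi / p) = pi / p" using p by simp
  note R = real_gaussian_moments[OF p]
  note C = has_bochner_integral_lborel_complex
  show 1: "has_bochner_integral lborel (\<lambda>z. exp (- (p * (cmod z)\<^sup>2))) (pi / p)"
    using C[OF R(1) R(1)] p by (simp add: s mult_exp_exp cmod_power2 algebra_simps)
  have v: "sqrt (pi / p) / (2 * p) * sqrt (pi / p) + sqrt (pi / p) * (sqrt (pi / p) / (2 * p)) = pi / p\<^sup>2"
    using s p by (simp add: field_simps power2_eq_square)
  show 2: "has_bochner_integral lborel (\<lambda>z. (cmod z)\<^sup>2 * exp (- (p * (cmod z)\<^sup>2))) (pi / p\<^sup>2)"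
    using has_bochner_integral_add[OF C[OF R(2) R(1)] C[OF R(1) R(2)]] unfolding v
    by (rule has_bochner_integral_cong[THEN iffD1, rotated 3])
       (auto simp: cmod_power2 algebra_simps exp_add[symmetric] simp flip: exp_add)
  let ?f = "\<lambda>z. z * complex_of_real (exp (- (p * (cmod z)\<^sup>2)))"
  have i: "integrable lborel ?f"
  proof (rule Bochner_Integration.integrable_bound)
    show "integrable lborel (\<lambda>z. exp (- (p * (cmod z)\<^sup>2)) + (cmod z)\<^sup>2 * exp (- (p * (cmod z)\<^sup>2)))"
      using 1 2 by (auto simp: has_bochner_integral_iff)
    \<comment> \<open>From (cmod z - 1)^2 >= 0. Thus the moments of order 0 and 2 dominate the one
      of order 1.\<close>
    have "cmod z \<le> 1 + (cmod z)\<^sup>2" for z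
      using zero_le_power2[of "cmod z - 1"] norm_ge_zero[of z] unfolding power2_diff power_one by linarith
    then have "cmod z * exp (- (p * (cmod z)\<^sup>2)) \<le> (1 + (cmod z)\<^sup>2) * exp (- (p * (cmod z)\<^sup>2))" for z
      by (rule mult_right_mono) simp
    then show "AE z in lborel. norm (?f z)
        \<le> norm (exp (- (p * (cmod z)\<^sup>2)) + (cmod z)\<^sup>2 * exp (- (p * (cmod z)\<^sup>2)))"
      by (auto simp: norm_mult distrib_right intro!: AE_I2)
  qed measurable
  \<comment> \<open>The integrand is odd, so reflection shows that its integral equals its own
    negative.\<close>
  have "has_bochner_integral lborel (\<lambda>z. - ?f z) (integral\<^sup>L lborel ?f)"
    using has_bochner_integral_lborel_reflect[OF has_bochner_integral_integrable[OF i]] by simp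
  moreover have "has_bochner_integral lborel (\<lambda>z. - ?f z) (- integral\<^sup>L lborel ?f)"
    using i by (intro has_bochner_integral_minus has_bochner_integral_integrable)
  ultimately have "integral\<^sup>L lborel ?f = - integral\<^sup>L lborel ?f"
    by (rule has_bochner_integral_eq)
  then have "integral\<^sup>L lborel ?f = 0" by simp
  with i show "has_bochner_integral lborel ?f 0" by (simp add: has_bochner_integral_iff)
qed

text \<open>The factor \<open>of_real p * z + g\<close> times w is minus the derivative of w with
  respect to the conjugate of z, so these are integrations by parts against 1 and
  \<open>cnj z\<close>. The proof completes the square instead: w is a multiple of a Gaussian
  centred at -g / p, and a translation reduces everything to the centred moments.\<close>

lemma tilted_complex_gaussian_stein:
  fixes p :: real and g :: complex
  assumes p: "p > 0"
  defines "w \<equiv> \<lambda>z. exp (- (2 * Re (cnj z * g) + p * (cmod z)\<^sup>2))"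
  shows "(\<integral>z. (of_real p * z + g) * of_real (w z) \<partial>lborel) = 0"
    and "(\<integral>z. (of_real p * z + g) * cnj z * of_real (w z) \<partial>lborel) = of_real (\<integral>z. w z \<partial>lborel)"
proof -
  define t where "t = g / of_real p"
  define c where "c = exp (p * (cmod t)\<^sup>2)"
  define e where "e u = exp (- (p * (cmod u)\<^sup>2))" for u
  note M = complex_gaussian_moments[OF p, folded e_def]
  have g: "g = of_real p * t" using p by (simp add: t_def)
  have w: "w z = c * e (t + z)" for z
    unfolding w_def c_def e_def mult_exp_exp g cmod_power2
    by (rule arg_cong[of _ _ exp]) (simp add: algebra_simps power2_eq_square)
  have "has_bochner_integral lborel (\<lambda>z. (of_real (p * c)) * (z * of_real (e z))) (of_real (p * c) * 0)"
    by (intro has_bochner_integral_mult_right M(3))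
  from has_bochner_integral_lborel_translate[OF this, of t]
  show "(\<integral>z. (of_real p * z + g) * of_real (w z) \<partial>lborel) = 0"
    by (intro has_bochner_integral_integral_eq) (simp add: w g algebra_simps)
  have "has_bochner_integral lborel (\<lambda>z. c * e z) (c * (pi / p))"
    by (intro has_bochner_integral_mult_right M(1))
  from has_bochner_integral_lborel_translate[OF this, of t]
  have C: "(\<integral>z. w z \<partial>lborel) = c * (pi / p)"
    by (intro has_bochner_integral_integral_eq) (simp add: w)
  \<comment> \<open>With u = t + z the integrand is p * u * (cnj u - cnj t) times the weight. The
    second part is a multiple of the vanishing first moment.\<close>
  have "has_bochner_integral lborel (\<lambda>z. of_real (p * c) * of_real ((cmod z)\<^sup>2 * e z) - of_real (p * c) * cnj t * (z * of_real (e z)))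
      (of_real (p * c) * of_real (pi / p\<^sup>2) - of_real (p * c) * cnj t * 0)"
    by (intro has_bochner_integral_diff has_bochner_integral_mult_right
        has_bochner_integral_of_real M)
  from has_bochner_integral_lborel_translate[OF this, of t]
  have "has_bochner_integral lborel (\<lambda>z. (of_real p * z + g) * cnj z * of_real (w z)) (complex_of_real (c * (pi / p)))"
  proof (rule has_bochner_integral_cong[THEN iffD1, rotated 3])
    fix z
    have "of_real ((cmod (t + z))\<^sup>2) = (t + z) * cnj (t + z)" 
      by (rule complex_norm_square)
    then show "of_real (p * c) * of_real ((cmod (t + z))\<^sup>2 * e (t + z)) - of_real (p * c) * cnj t * ((t + z) * of_real (e (t + z)))
       = (of_real p * z + g) * cnj z * of_real (w z)"
      by (simp add: w g algebra_simps del: of_real_power)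
  qed (use p in \<open>auto simp: power2_eq_square\<close>)
  then show "(\<integral>z. (of_real p * z + g) * cnj z * of_real (w z) \<partial>lborel) = of_real (\<integral>z. w z \<partial>lborel)"
    unfolding C by (rule has_bochner_integral_integral_eq)
qed

section \<open>Hermitian matrices and sesquilinear forms\<close>

lemma mat_adjoint_dim [simp]:
  "dim_row (mat_adjoint A) = dim_col A" "dim_col (mat_adjoint A) = dim_row A"
  by (auto simp: mat_adjoint_def)

lemma mat_adjoint_index [simp]:
  fixes A :: "complex mat"
  assumes "i < dim_col A" "j < dim_row A"
  shows "mat_adjoint A $$ (i, j) = cnj (A $$ (j, i))"
  using assms by (simp add: mat_adjoint_def mat_of_rows_def)

lemma mat_adjoint_mult:
  fixes A B :: "complex mat"
  assumes "A \<in> carrier_mat m n" "B \<in> carrier_mat n k"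
  shows "mat_adjoint (A * B) = mat_adjoint B * mat_adjoint A"
  using assms by (intro eq_matI) (auto simp: scalar_prod_def mult.commute)

lemma mat_inv_eqI:
  assumes A: "A \<in> carrier_mat n n" and B: "B \<in> carrier_mat n n" and AB: "A * B = 1\<^sub>m n"
  shows "mat_inv A = B"
proof -
  have BA: "B * A = 1\<^sub>m n"
    by (rule mat_mult_left_right_inverse[OF A B AB])
  then have "A \<in> Units (ring_mat TYPE(complex) n ())"
    using A B AB by (auto simp: Units_def ring_mat_def)
  then obtain C where C: "mat_inverse A = Some C"
    using mat_inverse(1)[OF A, where b = "()"] by (cases "mat_inverse A") auto
  from mat_inverse(2)[OF A C] have AC: "A * C = 1\<^sub>m n" and C': "C \<in> carrier_mat n n" by auto
  have "C = B * A * C" using BA C' by simp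
  also have "\<dots> = B" using A B C' AC by (simp add: assoc_mult_mat[of B n n A n C n])
  finally show ?thesis by (simp add: mat_inv_def C)
qed

lemma mat_inv_invertible:
  assumes A: "A \<in> carrier_mat n n" and det: "det A \<noteq> 0"
  shows "mat_inv A \<in> carrier_mat n n" "A * mat_inv A = 1\<^sub>m n" "mat_inv A * A = 1\<^sub>m n"
proof -
  obtain C where C: "mat_inverse A = Some C"
    using mat_inverse(1)[OF A, where b = "()"] det_non_zero_imp_unit[OF A det, of "()"]
    by (cases "mat_inverse A") auto
  from mat_inverse(2)[OF A C]
  show "mat_inv A \<in> carrier_mat n n" "A * mat_inv A = 1\<^sub>m n" "mat_inv A * A = 1\<^sub>m n"
    by (auto simp: mat_inv_def C)
qed

lemma hermitian_pos_def_eigenvalue_pos: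
  assumes A: "A \<in> carrier_mat n n" and pd: "hermitian_pos_def A" and ev: "eigenvalue A e"
  shows "0 < e"
proof -
  from ev A obtain v where v: "v \<in> carrier_vec n" "v \<noteq> 0\<^sub>v n" "A *\<^sub>v v = e \<cdot>\<^sub>v v"
    unfolding eigenvalue_def eigenvector_def by auto
  have "0 < (A *\<^sub>v v) \<bullet>c v"
    using pd v A by (auto simp: hermitian_pos_def_def)
  then have "0 < e * (v \<bullet>c v)" using v by simp
  moreover have "0 < v \<bullet>c v" using v by simp
  ultimately show ?thesis
    by (auto simp: less_complex_def zero_less_mult_iff)
qed

text \<open>Schur triangulation makes the determinant the product of the eigenvalues, each of which
  is positive.\<close>

lemma hermitian_pos_def_det_pos:
  assumes A: "A \<in> carrier_mat n n" and pd: "hermitian_pos_def A"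
  shows "0 < det A"
proof -
  obtain es where es: "char_poly A = (\<Prod>a\<leftarrow>es. [:- a, 1:])"
    using char_poly_factorized[OF A] by auto
  obtain B P Q where s: "schur_decomposition A es = (B, P, Q)"
    by (cases "schur_decomposition A es")
  from schur_decomposition[OF A es s]
  have B: "similar_mat_wit A B P Q" "upper_triangular B" "diag_mat B = es" by auto
  then have "det A = prod_list es"
    using det_similar[of A B] det_upper_triangular[OF B(2)] similar_mat_witD2[OF A B(1)]
    by (auto simp: similar_mat_def)
  moreover have "0 < a" if "a \<in> set es" for a
    using that by (intro hermitian_pos_def_eigenvalue_pos[OF A pd])
      (auto simp: eigenvalue_root_char_poly[OF A] es poly_prod_list prod_list_zero_iff)
  then have "0 < prod_list es"
    by (induction es) (auto simp: less_complex_def)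
  ultimately show ?thesis by simp
qed

text \<open>The form v^H W u for square W. Vectors are plain functions, so residuals can be added,
  scaled and updated without dimension side conditions.\<close>

definition sesq :: "complex mat \<Rightarrow> (nat \<Rightarrow> complex) \<Rightarrow> (nat \<Rightarrow> complex) \<Rightarrow> complex" where
  "sesq W u v = (\<Sum>a<dim_row W. \<Sum>b<dim_row W. W $$ (a, b) * u b * cnj (v a))"

lemma cscalar_prod_sesq:
  assumes "W \<in> carrier_mat n n" "u \<in> carrier_vec n" "v \<in> carrier_vec n"
  shows "(W *\<^sub>v u) \<bullet>c v = sesq W (\<lambda>i. u $ i) (\<lambda>i. v $ i)"
  using assms by (auto simp: sesq_def scalar_prod_def sum_distrib_right atLeast0LessThan)

lemma sesq_cong:
  assumes "\<And>i. i < dim_row W \<Longrightarrow> u i = u' i" "\<And>i. i < dim_row W \<Longrightarrow> v i = v' i"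
  shows "sesq W u v = sesq W u' v'"
  using assms by (simp add: sesq_def)

lemma sesq_diff_left: "sesq W (\<lambda>i. u i - u' i) v = sesq W u v - sesq W u' v"
  by (simp add: sesq_def algebra_simps sum_subtractf)

lemma sesq_diff_right: "sesq W u (\<lambda>i. v i - v' i) = sesq W u v - sesq W u v'"
  by (simp add: sesq_def algebra_simps sum_subtractf)

lemma sesq_mult_left: "sesq W (\<lambda>i. u i * c) v = sesq W u v * c"
  by (simp add: sesq_def algebra_simps sum_distrib_left)

lemma sesq_mult_right: "sesq W u (\<lambda>i. v i * c) = sesq W u v * cnj c"
  by (simp add: sesq_def algebra_simps sum_distrib_left)

lemma sesq_sum_left: "sesq W (\<lambda>i. \<Sum>l\<in>S. u l i) v = (\<Sum>l\<in>S. sesq W (u l) v)"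
  by (induction S rule: infinite_finite_induct)
    (simp_all add: sesq_def algebra_simps sum.distrib)

lemma sesq_hermitian:
  assumes W: "W \<in> carrier_mat n n" and "mat_adjoint W = W"
  shows "sesq W v u = cnj (sesq W u v)"
proof -
  have c: "cnj (W $$ (a, b)) = W $$ (b, a)" if "a < n" "b < n" for a b
    using mat_adjoint_index[of b W a] assms that by auto
  have "cnj (sesq W u v) = (\<Sum>a<n. \<Sum>b<n. W $$ (b, a) * v a * cnj (u b))"
    using W by (simp add: sesq_def c algebra_simps)
  also have "\<dots> = sesq W v u"
    using W by (subst sum.swap) (simp add: sesq_def)
  finally show ?thesis ..
qed

text \<open>Describes the misfit as a function of one entry z of H: \<alpha> will be a column of A
  and r the residual with that entry set to 0. Hermitian symmetry merges the two cross terms into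
  twice a real part.\<close>

lemma sesq_quadratic_expansion:
  assumes "W \<in> carrier_mat n n" "mat_adjoint W = W"
  shows "Re (sesq W (\<lambda>i. r i - \<alpha> i * z) (\<lambda>i. r i - \<alpha> i * z)) =
    Re (sesq W r r) + 2 * Re (cnj z * - sesq W r \<alpha>) + Re (sesq W \<alpha> \<alpha>) * (cmod z)\<^sup>2"
proof -
  have "Im (sesq W \<alpha> \<alpha>) = 0"
    using arg_cong[OF sesq_hermitian[OF assms, of \<alpha> \<alpha>], of Im] by simp
  then show ?thesis
    unfolding sesq_diff_left sesq_diff_right sesq_mult_left sesq_mult_right cmod_power2
    by (simp add: sesq_hermitian[OF assms, of \<alpha> r] algebra_simps power2_eq_square)
qed

lemma hermitian_pos_def_inverse:
  assumes A: "A \<in> carrier_mat n n" and pd: "hermitian_pos_def A"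
  shows "mat_inv A \<in> carrier_mat n n" "mat_adjoint (mat_inv A) = mat_inv A"
    and "0 \<le> Re (sesq (mat_inv A) u u)"
proof -
  have det: "det A \<noteq> 0" using hermitian_pos_def_det_pos[OF A pd] by auto
  define W where "W = mat_inv A"
  note W = mat_inv_invertible[OF A det, folded W_def]
  have adj: "mat_adjoint A = A" using pd by (simp add: hermitian_pos_def_def)
  have adjW: "mat_adjoint W \<in> carrier_mat n n" using W(1) by auto
  \<comment> \<open>The adjoint of \<open>A * W = 1\<^sub>m n\<close>, as A is its own adjoint.
    Uniqueness of the inverse then makes W Hermitian.\<close>
  have "mat_adjoint W * A = 1\<^sub>m n"
    using arg_cong[OF W(2), of mat_adjoint] mat_adjoint_mult[OF A W(1)] adj
    by (auto intro!: eq_matI)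
  then have "A * mat_adjoint W = 1\<^sub>m n" by (rule mat_mult_left_right_inverse[OF adjW A])
  then have herm: "mat_adjoint W = W" using mat_inv_eqI[OF A adjW] by (simp add: W_def)
  \<comment> \<open>For x = W v the form of W at v is, up to conjugation, the form of A at x, which
    is nonnegative.\<close>
  define v where "v = vec n u"
  define x where "x = W *\<^sub>v v"
  have v: "v \<in> carrier_vec n" and x: "x \<in> carrier_vec n" using W(1) by (auto simp: v_def x_def)
  have Ax: "A *\<^sub>v x = v" using W A v by (simp add: x_def flip: assoc_mult_mat_vec)
  have "0 \<le> Re ((A *\<^sub>v x) \<bullet>c x)"
    using pd A x by (cases "x = 0\<^sub>v n") (auto simp: hermitian_pos_def_def less_complex_def)
  also have "(A *\<^sub>v x) \<bullet>c x = cnj (x \<bullet>c v)"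
    using v x unfolding Ax by (simp add: scalar_prod_def mult.commute)
  also have "x \<bullet>c v = sesq W u u"
    using W(1) v unfolding x_def
    by (subst cscalar_prod_sesq[OF W(1) v v]) (auto intro!: sesq_cong simp: v_def)
  finally show "mat_inv A \<in> carrier_mat n n" "mat_adjoint (mat_inv A) = mat_inv A"
      "0 \<le> Re (sesq (mat_inv A) u u)"
    using W herm by (auto simp: W_def)
qed

lemma hyper_mat_inverse:
  assumes d: "d > 0" "d dvd n" and \<psi>: "\<forall>i<n div d. \<psi> i \<noteq> 0"
  shows "mat_inv (hyper_mat (n div d) d \<psi>) = mat_diag n (\<lambda>j. inverse (complex_of_real (\<psi> (j div d))))"
proof (rule mat_inv_eqI)
  have nd: "n div d * d = n" using d by auto
  have div: "j div d < n div d" if "j < n" for j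
    using that nd d by (metis less_mult_imp_div_less)
  \<comment> \<open>An entry of the Kronecker product survives only if both quotients and both
    remainders agree, hence only on the diagonal.\<close>
  have eq: "i = j" if "i div d = j div d" "i mod d = j mod d" for i j
    using that by (metis div_mult_mod_eq)
  have H: "hyper_mat (n div d) d \<psi> = mat_diag n (\<lambda>j. complex_of_real (\<psi> (j div d)))"
    using d nd div by (intro eq_matI) (auto simp: hyper_mat_def kronecker_def mat_diag_def dest: eq)
  show "hyper_mat (n div d) d \<psi> \<in> carrier_mat n n"
    unfolding H by simp
  show "hyper_mat (n div d) d \<psi> * mat_diag n (\<lambda>j. inverse (complex_of_real (\<psi> (j div d)))) = 1\<^sub>m n"
    unfolding H mat_diag_diag using \<psi> div
    by (intro eq_matI) (auto simp: mat_diag_def)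
qed simp

section \<open>Stein identities and Gaussian moments\<close>

text \<open>In the following hypotheses, G h is the derivative of \<open>- ln f\<close> at h with respect to the
  conjugate of the coordinate h i.\<close>

context
  fixes I :: "'i set" and i :: 'i and p :: real
    and f :: "('i \<Rightarrow> complex) \<Rightarrow> real" and G :: "('i \<Rightarrow> complex) \<Rightarrow> complex"
  assumes I: "finite I" "i \<in> I" and p: "p > 0"
    and f: "\<And>h z. f (h(i := z)) =
      f (h(i := 0)) * exp (- (2 * Re (cnj z * G (h(i := 0))) + p * (cmod z)\<^sup>2))"
    and G: "\<And>h z. G (h(i := z)) = of_real p * z + G (h(i := 0))"
begin

lemma gaussian_coordinate_integral:
  fixes F :: "('i \<Rightarrow> complex) \<Rightarrow> 'b::{banach, second_countable_topology}"
  assumes "integrable (\<Pi>\<^sub>M i\<in>I. lborel) F"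
  shows "(\<integral>h. F h \<partial>(\<Pi>\<^sub>M i\<in>I. lborel)) =
    (\<integral>h. (\<integral>z. F (h(i := z)) \<partial>lborel) \<partial>(\<Pi>\<^sub>M i\<in>I - {i}. lborel))"
proof -
  interpret product_sigma_finite "\<lambda>_::'i. lborel :: complex measure" ..
  have "insert i (I - {i}) = I" using I by auto
  then show ?thesis
    using product_integral_insert[of "I - {i}" i F] I assms by simp
qed

text \<open>Along coordinate i the test function is a constant factor, so the inner integral of
  Fubini's theorem vanishes for every choice of the other coordinates.\<close>

lemma stein_orthogonal:
  assumes \<phi>: "\<And>h z. \<phi> (h(i := z)) = (\<phi> h :: complex)"
    and int: "integrable (\<Pi>\<^sub>M i\<in>I. lborel) (\<lambda>h. of_real (f h) * (G h * \<phi> h))"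
  shows "(\<integral>h. of_real (f h) * (G h * \<phi> h) \<partial>(\<Pi>\<^sub>M i\<in>I. lborel)) = 0"
proof -
  have "(\<integral>z. of_real (f (h(i := z))) * (G (h(i := z)) * \<phi> (h(i := z))) \<partial>lborel) = 0" for h
  proof -
    let ?w = "\<lambda>z. exp (- (2 * Re (cnj z * G (h(i := 0))) + p * (cmod z)\<^sup>2))"
    have "(\<integral>z. of_real (f (h(i := z))) * (G (h(i := z)) * \<phi> (h(i := z))) \<partial>lborel) =
      (\<integral>z. of_real (f (h(i := 0))) * \<phi> h * ((of_real p * z + G (h(i := 0))) * of_real (?w z)) \<partial>lborel)"
      by (subst f, subst G, subst \<phi>) (simp add: mult_ac)
    also have "\<dots> = 0"
      by (subst integral_mult_right_zero) (simp only: tilted_complex_gaussian_stein(1)[OF p] mult_zero_right)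
    finally show ?thesis .
  qed
  then show ?thesis
    by (simp add: gaussian_coordinate_integral[OF int])
qed

text \<open>Here the test function moves with coordinate i itself, and the inner integral reproduces
  that of f instead of vanishing.\<close>

lemma stein_diagonal:
  assumes int: "integrable (\<Pi>\<^sub>M i\<in>I. lborel) (\<lambda>h. of_real (f h) * (G h * cnj (h i)))"
    and int': "integrable (\<Pi>\<^sub>M i\<in>I. lborel) f"
  shows "(\<integral>h. of_real (f h) * (G h * cnj (h i)) \<partial>(\<Pi>\<^sub>M i\<in>I. lborel)) =
    of_real (\<integral>h. f h \<partial>(\<Pi>\<^sub>M i\<in>I. lborel))"
proof -
  have "(\<integral>z. of_real (f (h(i := z))) * (G (h(i := z)) * cnj ((h(i := z)) i)) \<partial>lborel) =
      of_real (\<integral>z. f (h(i := z)) \<partial>lborel)" for h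
  proof -
    let ?w = "\<lambda>z. exp (- (2 * Re (cnj z * G (h(i := 0))) + p * (cmod z)\<^sup>2))"
    have "(\<integral>z. of_real (f (h(i := z))) * (G (h(i := z)) * cnj ((h(i := z)) i)) \<partial>lborel) =
      (\<integral>z. of_real (f (h(i := 0))) * ((of_real p * z + G (h(i := 0))) * cnj z * of_real (?w z)) \<partial>lborel)"
      by (subst f, subst G) (simp add: mult_ac)
    also have "\<dots> = of_real (f (h(i := 0))) * of_real (\<integral>z. ?w z \<partial>lborel)"
      by (subst integral_mult_right_zero) (simp only: tilted_complex_gaussian_stein(2)[OF p])
    also have "\<dots> = of_real (\<integral>z. f (h(i := z)) \<partial>lborel)"
      by (subst (2) f) simp
    finally show ?thesis .
  qed
  then show ?thesis
    by (simp add: gaussian_coordinate_integral[OF int] gaussian_coordinate_integral[OF int'])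
qed

end

text \<open>The Stein identities with test functions 1 and \<open>cnj (h (s, k))\<close> say that P maps the mean to b and
  that P times the covariance is the identity.\<close>

lemma gaussian_second_moment:
  fixes f :: "(nat \<times> nat \<Rightarrow> complex) \<Rightarrow> real" and P b :: "complex mat"
    and n K :: nat and p :: "nat \<Rightarrow> real"
  defines "L \<equiv> \<Pi>\<^sub>M x\<in>{..<n} \<times> {..<K}. (lborel :: complex measure)"
    and "G \<equiv> \<lambda>j k h. (\<Sum>l<n. P $$ (j, l) * h (l, k)) - b $$ (j, k)"
  assumes P: "P \<in> carrier_mat n n" and b: "b \<in> carrier_mat n K"
    and p: "\<And>j. j < n \<Longrightarrow> p j > 0" "\<And>j. j < n \<Longrightarrow> P $$ (j, j) = of_real (p j)"
    and f: "\<And>j k h z. j < n \<Longrightarrow> k < K \<Longrightarrow> f (h((j, k) := z)) =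
      f (h((j, k) := 0)) * exp (- (2 * Re (cnj z * G j k (h((j, k) := 0))) + p j * (cmod z)\<^sup>2))"
    and f0: "\<And>h. f h \<ge> 0"
    and int: "integrable L f" "(\<integral>h. f h \<partial>L) = 1"
    and int2: "\<And>x. x \<in> {..<n} \<times> {..<K} \<Longrightarrow> integrable L (\<lambda>h. f h * (cmod (h x))\<^sup>2)"
    and jk: "j < n" "k < K"
  shows "of_real (\<integral>h. f h * (cmod (h (j, k)))\<^sup>2 \<partial>L) =
      of_real ((cmod ((mat_inv P * b) $$ (j, k)))\<^sup>2) + mat_inv P $$ (j, j)"
    and "0 < (\<integral>h. f h * (cmod (h (j, k)))\<^sup>2 \<partial>L)"
    and "mat_inv P \<in> carrier_mat n n"
proof -
  have [measurable]: "f \<in> borel_measurable L" using int(1) by auto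
  have [measurable]: "(\<lambda>h. h (l, k)) \<in> borel_measurable L" if "l < n" for l
    using that jk measurable_component_singleton[of "(l, k)" "{..<n} \<times> {..<K}" "\<lambda>_. lborel :: complex measure"]
    by (simp add: L_def)
  have [measurable]: "(\<lambda>h. cnj (h (l, k))) \<in> borel_measurable L" if "l < n" for l
    using that by (intro borel_measurable_continuous_on[where f = cnj] continuous_intros) measurable
  define E where "E \<phi> = (\<integral>h. of_real (f h) * \<phi> h \<partial>L)" for \<phi> :: "(nat \<times> nat \<Rightarrow> complex) \<Rightarrow> complex"
  have i0: "integrable L (\<lambda>h. complex_of_real (f h))"
    using int(1) by (rule integrable_of_real)
  \<comment> \<open>All moments up to order two are dominated by the given ones: u <= 1 + u^2 here,
    and u * v <= u^2 + v^2 for the mixed ones in \<open>i2\<close>.\<close>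
  have i1: "integrable L (\<lambda>h. of_real (f h) * h (l, k))" if l: "l < n" for l
  proof (rule Bochner_Integration.integrable_bound)
    show "integrable L (\<lambda>h. f h + f h * (cmod (h (l, k)))\<^sup>2)"
      using int int2 l jk by auto
    have "cmod z \<le> 1 + (cmod z)\<^sup>2" for z
      using zero_le_power2[of "cmod z - 1"] norm_ge_zero[of z] unfolding power2_diff power_one by linarith
    then have "f h * cmod (h (l, k)) \<le> f h * (1 + (cmod (h (l, k)))\<^sup>2)" for h
      using f0 by (rule mult_left_mono)
    then show "AE h in L. norm (of_real (f h) * h (l, k)) \<le> norm (f h + f h * (cmod (h (l, k)))\<^sup>2)"
      using f0 by (auto simp: norm_mult distrib_left intro!: AE_I2)
  qed (use l in measurable)
  have i2: "integrable L (\<lambda>h. of_real (f h) * (h (l, k) * cnj (h (i, k))))" if l: "l < n" and i: "i < n" for l i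
  proof (rule Bochner_Integration.integrable_bound)
    show "integrable L (\<lambda>h. f h * (cmod (h (l, k)))\<^sup>2 + f h * (cmod (h (i, k)))\<^sup>2)"
      using int2 i l jk by auto
    have "u * v \<le> u\<^sup>2 + v\<^sup>2" if "u \<ge> 0" "v \<ge> 0" for u v :: real
      using zero_le_power2[of "u - v"] mult_nonneg_nonneg[OF that] unfolding power2_diff by linarith
    then have "f h * (cmod (h (l, k)) * cmod (h (i, k))) \<le> f h * ((cmod (h (l, k)))\<^sup>2 + (cmod (h (i, k)))\<^sup>2)" for h
      using f0 by (intro mult_left_mono) auto
    then show "AE h in L. norm (of_real (f h) * (h (l, k) * cnj (h (i, k))))
        \<le> norm (f h * (cmod (h (l, k)))\<^sup>2 + f h * (cmod (h (i, k)))\<^sup>2)"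
      using f0 by (auto simp: norm_mult distrib_left intro!: AE_I2)
  qed (use l i in measurable)
  have i1': "integrable L (\<lambda>h. of_real (f h) * cnj (h (l, k)))" if "l < n" for l
    using integrable_cnj[OF i1[OF that]] by simp
  define m where "m l = E (\<lambda>h. h (l, k))" for l
  have E1: "E (\<lambda>_. 1) = 1"
    using int by (simp add: E_def)
  have Ecnj: "E (\<lambda>h. cnj (h (l, k))) = cnj (m l)" for l
    using Bochner_Integration.integral_cnj[of L "\<lambda>h. of_real (f h) * h (l, k)"] by (simp add: m_def E_def)
  have EG: "integrable L (\<lambda>h. of_real (f h) * (G i k h * \<phi> h))"
      "E (\<lambda>h. G i k h * \<phi> h) = (\<Sum>l<n. P $$ (i, l) * E (\<lambda>h. h (l, k) * \<phi> h)) - b $$ (i, k) * E \<phi>"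
    if "integrable L (\<lambda>h. of_real (f h) * \<phi> h)"
       "\<And>l. l < n \<Longrightarrow> integrable L (\<lambda>h. of_real (f h) * (h (l, k) * \<phi> h))" for i \<phi>
  proof -
    have eq: "of_real (f h) * (G i k h * \<phi> h) =
        (\<Sum>l<n. P $$ (i, l) * (of_real (f h) * (h (l, k) * \<phi> h))) - b $$ (i, k) * (of_real (f h) * \<phi> h)" for h
      by (simp add: G_def algebra_simps sum_distrib_left)
    show "integrable L (\<lambda>h. of_real (f h) * (G i k h * \<phi> h))"
      unfolding eq using that by (intro Bochner_Integration.integrable_diff Bochner_Integration.integrable_sum integrable_mult_right) auto
    show "E (\<lambda>h. G i k h * \<phi> h) = (\<Sum>l<n. P $$ (i, l) * E (\<lambda>h. h (l, k) * \<phi> h)) - b $$ (i, k) * E \<phi>"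
      unfolding E_def eq using that
      by (subst Bochner_Integration.integral_diff Bochner_Integration.integral_sum;
          (intro Bochner_Integration.integrable_sum integrable_mult_right)?; simp)+
  qed
  \<comment> \<open>Changing entry (i, k) affects only the summand l = i, whose coefficient is the
    diagonal entry of P.\<close>
  have G: "G i k (h((i, k) := z)) = of_real (p i) * z + G i k (h((i, k) := 0))" if i: "i < n" for i h z
  proof -
    have "(\<Sum>l<n. P $$ (i, l) * (h((i, k) := z)) (l, k)) =
        P $$ (i, i) * z + (\<Sum>l\<in>{..<n} - {i}. P $$ (i, l) * h (l, k))" for z
      using i by (subst sum.remove[of _ i]) (auto intro!: sum.cong)
    then show ?thesis using p(2)[OF i] unfolding G_def by (simp del: fun_upd_apply)
  qed
  have fin: "finite ({..<n} \<times> {..<K})" by simp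
  have ik: "(i, k) \<in> {..<n} \<times> {..<K}" if "i < n" for i using that jk by simp
  have stein0: "E (\<lambda>h. G i k h * \<phi> h) = 0"
    if i: "i < n" and \<phi>: "\<And>h z. \<phi> (h((i, k) := z)) = \<phi> h"
      and int: "integrable L (\<lambda>h. of_real (f h) * (G i k h * \<phi> h))" for i \<phi>
    unfolding E_def L_def
  proof (rule stein_orthogonal[OF fin ik[OF i] p(1)[OF i]])
    show "f (h((i, k) := z)) = f (h((i, k) := 0)) *
        exp (- (2 * Re (cnj z * G i k (h((i, k) := 0))) + p i * (cmod z)\<^sup>2))" for h z
      by (rule f[OF i jk(2)])
    show "G i k (h((i, k) := z)) = of_real (p i) * z + G i k (h((i, k) := 0))" for h z
      by (rule G[OF i])
  qed (use \<phi> int in \<open>auto simp: L_def\<close>)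
  have stein1: "E (\<lambda>h. G i k h * cnj (h (i, k))) = 1"
    if i: "i < n" and int': "integrable L (\<lambda>h. of_real (f h) * (G i k h * cnj (h (i, k))))" for i
  proof -
    have "E (\<lambda>h. G i k h * cnj (h (i, k))) = of_real (\<integral>h. f h \<partial>L)"
      unfolding E_def L_def
    proof (rule stein_diagonal[OF fin ik[OF i] p(1)[OF i]])
      show "f (h((i, k) := z)) = f (h((i, k) := 0)) *
          exp (- (2 * Re (cnj z * G i k (h((i, k) := 0))) + p i * (cmod z)\<^sup>2))" for h z
        by (rule f[OF i jk(2)])
      show "G i k (h((i, k) := z)) = of_real (p i) * z + G i k (h((i, k) := 0))" for h z
        by (rule G[OF i])
    qed (use int int' in \<open>auto simp: L_def\<close>)
    then show ?thesis by (simp add: int)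
  qed
  have Pm: "(\<Sum>l<n. P $$ (i, l) * m l) = b $$ (i, k)" if i: "i < n" for i
  proof -
    have "E (\<lambda>h. G i k h * 1) = 0"
      using EG(1)[of "\<lambda>_. 1"] i i0 i1 jk by (intro stein0) auto
    then show ?thesis using EG(2)[of "\<lambda>_. 1" i] i0 i1 E1 by (simp add: m_def)
  qed
  have PE: "(\<Sum>l<n. P $$ (i, l) * E (\<lambda>h. h (l, k) * cnj (h (s, k)))) - b $$ (i, k) * cnj (m s) =
      (if i = s then 1 else 0)" if i: "i < n" and s: "s < n" for i s
  proof -
    \<comment> \<open>For s distinct from i the coordinate (s, k) does not move with (i, k), and the
      orthogonal identity applies; for s = i it is the diagonal one.\<close>
    have "E (\<lambda>h. G i k h * cnj (h (s, k))) = (if i = s then 1 else 0)"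
    proof (cases "i = s")
      case True
      then show ?thesis
        using EG(1)[of "\<lambda>h. cnj (h (s, k))" i] i i1' i2 jk int stein1[of i] by simp
    next
      case False
      then have "E (\<lambda>h. G i k h * cnj (h (s, k))) = 0"
        using EG(1)[of "\<lambda>h. cnj (h (s, k))" i] i s i1' i2 jk by (intro stein0) auto
      with False show ?thesis by simp
    qed
    then show ?thesis using EG(2)[of "\<lambda>h. cnj (h (s, k))" i] s i1' i2 by (simp add: Ecnj)
  qed
  \<comment> \<open>The covariance of column k. By \<open>Pm\<close>, the term with b in
    \<open>PE\<close> is exactly the correction that centres the second moments.\<close>
  define C where "C = mat n n (\<lambda>(l, s). E (\<lambda>h. h (l, k) * cnj (h (s, k))) - m l * cnj (m s))"
  have C: "C \<in> carrier_mat n n" by (simp add: C_def)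
  have "P * C = 1\<^sub>m n"
  proof (rule eq_matI)
    fix i s assume "i < dim_row (1\<^sub>m n :: complex mat)" "s < dim_col (1\<^sub>m n :: complex mat)"
    then have ij: "i < n" "s < n" by auto
    have "(P * C) $$ (i, s) = (\<Sum>l<n. P $$ (i, l) * (E (\<lambda>h. h (l, k) * cnj (h (s, k))) - m l * cnj (m s)))"
      using ij P C by (simp add: scalar_prod_def C_def atLeast0LessThan)
    also have "\<dots> = (\<Sum>l<n. P $$ (i, l) * E (\<lambda>h. h (l, k) * cnj (h (s, k)))) - (\<Sum>l<n. P $$ (i, l) * m l) * cnj (m s)"
      by (simp add: algebra_simps sum_subtractf sum_distrib_left)
    also have "\<dots> = (if i = s then 1 else 0)" using PE Pm ij by simp
    finally show "(P * C) $$ (i, s) = 1\<^sub>m n $$ (i, s)" using ij by simp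
  qed (use P C in auto)
  \<comment> \<open>A right inverse of a square matrix is two-sided, so this also establishes that P
    is invertible.\<close>
  then have inv: "mat_inv P = C" and CP: "C * P = 1\<^sub>m n"
    using mat_inv_eqI[OF P C] mat_mult_left_right_inverse[OF P C] by auto
  show "mat_inv P \<in> carrier_mat n n" using C by (simp add: inv)
  have "P *\<^sub>v vec n m = col b k"
    using P b jk Pm by (intro eq_vecI) (auto simp: scalar_prod_def atLeast0LessThan)
  then have "C *\<^sub>v col b k = vec n m"
    using assoc_mult_mat_vec[OF C P, of "vec n m"] by (simp add: CP)
  then have "m j = (mat_inv P * b) $$ (j, k)"
    using jk C b unfolding inv by (metis carrier_matD index_mult_mat(1) index_mult_mat_vec index_vec)
  moreover have sq: "E (\<lambda>h. h (j, k) * cnj (h (j, k))) = of_real (\<integral>h. f h * (cmod (h (j, k)))\<^sup>2 \<partial>L)"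
    unfolding E_def complex_norm_square[symmetric] of_real_mult[symmetric] by (rule integral_complex_of_real)
  moreover have "C $$ (j, j) = E (\<lambda>h. h (j, k) * cnj (h (j, k))) - m j * cnj (m j)"
    using jk by (simp add: C_def)
  ultimately show "of_real (\<integral>h. f h * (cmod (h (j, k)))\<^sup>2 \<partial>L) =
      of_real ((cmod ((mat_inv P * b) $$ (j, k)))\<^sup>2) + mat_inv P $$ (j, j)"
    unfolding complex_norm_square by (simp add: inv)
  show "0 < (\<integral>h. f h * (cmod (h (j, k)))\<^sup>2 \<partial>L)"
  proof (rule ccontr)
    assume "\<not> 0 < (\<integral>h. f h * (cmod (h (j, k)))\<^sup>2 \<partial>L)"
    moreover have "0 \<le> (\<integral>h. f h * (cmod (h (j, k)))\<^sup>2 \<partial>L)"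
      using f0 by (intro Bochner_Integration.integral_nonneg) simp
    ultimately have zero: "(\<integral>h. f h * (cmod (h (j, k)))\<^sup>2 \<partial>L) = 0" by linarith
    \<comment> \<open>A vanishing second moment forces
      \<open>f h * (cmod (h (j, k)))\<^sup>2 = 0\<close> almost everywhere. Then the integrand of
      \<open>stein1\<close> vanishes almost everywhere too, although its integral is 1.\<close>
    have "AE h in L. f h * (cmod (h (j, k)))\<^sup>2 = 0"
      by (rule integral_nonneg_eq_0_iff_AE[THEN iffD1, OF int2[OF ik[OF jk(1)]] _ zero]) (simp add: f0)
    then have "E (\<lambda>h. G j k h * cnj (h (j, k))) = (\<integral>h. 0 \<partial>L)"
      unfolding E_def using EG(1)[of "\<lambda>h. cnj (h (j, k))" j] i1' i2 jk
      by (intro integral_cong_AE) auto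
    moreover have "E (\<lambda>h. G j k h * cnj (h (j, k))) = 1"
      using EG(1)[of "\<lambda>h. cnj (h (j, k))" j] i1' i2 jk int stein1[of j] by simp
    ultimately show False by simp
  qed
qed

section \<open>The grouped linear Gaussian model\<close>

text \<open>The gap between F at its maximum and at another point is a sum of terms \<open>c (u - 1 - ln u)\<close>.\<close>

lemma is_arg_max_log_inverse_sum:
  fixes F :: "(nat \<Rightarrow> real) \<Rightarrow> real" and T :: "nat \<Rightarrow> real"
  assumes c: "c > 0" and q: "q > 0" and T: "\<And>i. i < g \<Longrightarrow> T i > 0"
    and F: "\<And>\<psi>. \<forall>i<g. \<psi> i > 0 \<Longrightarrow> F \<psi> = B - (\<Sum>i<g. c * ln (q * \<psi> i) + T i / \<psi> i)"
  shows "is_arg_max F (\<lambda>\<psi>. \<forall>i<g. \<psi> i > 0) \<psi> \<longleftrightarrow> (\<forall>i<g. \<psi> i = T i / c)"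
proof -
  define t where "t i = T i / c" for i
  have t: "t i > 0" if "i < g" for i using T[OF that] c by (simp add: t_def)
  define \<phi> where "\<phi> i s = c * ln (q * s) + T i / s" for i s
  have gap: "\<phi> i s - \<phi> i (t i) = c * (t i / s - 1 - ln (t i / s))" if "i < g" "s > 0" for i s
    using t[OF that(1)] that(2) c q by (simp add: \<phi>_def t_def field_simps ln_mult ln_div)
  have le: "\<phi> i (t i) \<le> \<phi> i s" if "i < g" "s > 0" for i s
  proof -
    have "ln (t i / s) \<le> t i / s - 1" using t[OF that(1)] that by (intro ln_le_minus_one) simp
    then have "0 \<le> \<phi> i s - \<phi> i (t i)" unfolding gap[OF that] using c by simp
    then show ?thesis by simp
  qed
  have eq: "s = t i" if "i < g" "s > 0" "\<phi> i (t i) = \<phi> i s" for i s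
  proof -
    have "ln (t i / s) = t i / s - 1" using gap[OF that(1,2)] that(3) c by simp
    then have "t i / s = 1" using t[OF that(1)] that(2) by (intro ln_eq_minus_one) auto
    then show ?thesis using that(2) by simp
  qed
  have Ft: "F t = B - (\<Sum>i<g. \<phi> i (t i))" using F[of t] t by (simp add: \<phi>_def)
  have F': "F \<psi> = B - (\<Sum>i<g. \<phi> i (\<psi> i))" if "\<forall>i<g. \<psi> i > 0" for \<psi>
    using F[OF that] by (simp add: \<phi>_def)
  show ?thesis
  proof
    assume max: "is_arg_max F (\<lambda>\<psi>. \<forall>i<g. \<psi> i > 0) \<psi>"
    then have pos: "\<forall>i<g. \<psi> i > 0" by (simp add: is_arg_max_def)
    \<comment> \<open>The point t is admissible. As t minimizes every summand separately, comparing
      the two sums forces equality summand by summand.\<close>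
    have "F t \<le> F \<psi>" using max t by (auto simp: is_arg_max_linorder)
    then have "(\<Sum>i<g. \<phi> i (\<psi> i)) \<le> (\<Sum>i<g. \<phi> i (t i))" by (simp add: F'[OF pos] Ft)
    moreover have "(\<Sum>i<g. \<phi> i (t i)) \<le> (\<Sum>i<g. \<phi> i (\<psi> i))"
      using le pos by (intro sum_mono) auto
    ultimately have sums: "(\<Sum>i<g. \<phi> i (t i)) = (\<Sum>i<g. \<phi> i (\<psi> i))" by simp
    have "\<phi> i (t i) = \<phi> i (\<psi> i)" if "i < g" for i
      using sum_mono_inv[OF sums, of i] le pos that by simp
    then show "\<forall>i<g. \<psi> i = T i / c" using eq pos by (auto simp: t_def)
  next
    assume \<psi>: "\<forall>i<g. \<psi> i = T i / c"
    then have pos: "\<forall>i<g. \<psi> i > 0" using t by (simp add: t_def)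
    have "F \<psi>' \<le> F \<psi>" if "\<forall>i<g. \<psi>' i > 0" for \<psi>'
      unfolding F'[OF that] F'[OF pos] using le that \<psi> 
      by (auto intro!: sum_mono simp flip: t_def)
    with pos show "is_arg_max F (\<lambda>\<psi>. \<forall>i<g. \<psi> i > 0) \<psi>" by (simp add: is_arg_max_linorder)
  qed
qed

lemma sum_groups:
  fixes f :: "nat \<Rightarrow> 'a::comm_monoid_add"
  assumes "d dvd n"
  shows "(\<Sum>j<n. f j) = (\<Sum>i<n div d. \<Sum>j=i*d..<(i+1)*d. f j)"
  using sum.nat_group[of f d "n div d"] assms by (simp add: algebra_simps)

text \<open>The argument is carried out for an arbitrary m by n matrix A; the convolution matrix is
  substituted at the end.\<close>

locale grouped_linear_gaussian_model =
  fixes A Rv Y :: "complex mat" and m n K d :: nat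
  assumes A: "A \<in> carrier_mat m n" and Rv: "Rv \<in> carrier_mat m m" "hermitian_pos_def Rv"
    and Y: "Y \<in> carrier_mat m K" and K: "K > 0" and d: "d > 0" "d dvd n"
begin

abbreviation W :: "complex mat" where "W \<equiv> mat_inv Rv"

abbreviation L :: "(nat \<times> nat \<Rightarrow> complex) measure" where
  "L \<equiv> \<Pi>\<^sub>M x\<in>{..<n} \<times> {..<K}. lborel"

definition pos :: "(nat \<Rightarrow> real) \<Rightarrow> bool" where "pos \<psi> \<longleftrightarrow> (\<forall>i<n div d. \<psi> i > 0)"

text \<open>Column k of Y - A H, in terms of the entry function h, so that changing one entry of H
  is a function update.\<close>

definition resid :: "(nat \<times> nat \<Rightarrow> complex) \<Rightarrow> nat \<Rightarrow> nat \<Rightarrow> complex" where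
  "resid h k a = Y $$ (a, k) - (\<Sum>l<n. A $$ (a, l) * h (l, k))"

text \<open>The negative exponent of the likelihood; \<open>energy\<close> is that of the prior, and
  \<open>log_const\<close> collects the logarithms of both normalizing factors.\<close>

definition misfit :: "(nat \<times> nat \<Rightarrow> complex) \<Rightarrow> real" where
  "misfit h = (\<Sum>k<K. Re (sesq W (resid h k) (resid h k)))"

definition energy :: "(nat \<Rightarrow> real) \<Rightarrow> (nat \<times> nat \<Rightarrow> complex) \<Rightarrow> real" where
  "energy \<psi> h = (\<Sum>x\<in>{..<n} \<times> {..<K}. (cmod (h x))\<^sup>2 / \<psi> (fst x div d))"

definition log_const :: "(nat \<Rightarrow> real) \<Rightarrow> real" where
  "log_const \<psi> = - (K * ln (pi ^ m * Re (det Rv))) - (\<Sum>i<n div d. d * K * ln (pi * \<psi> i))"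

abbreviation joint :: "(nat \<Rightarrow> real) \<Rightarrow> (nat \<times> nat \<Rightarrow> complex) \<Rightarrow> real" where
  "joint \<psi> h \<equiv> joint_density A Rv d \<psi> Y (mat n K h)"

lemma W: "W \<in> carrier_mat m m" "mat_adjoint W = W" "0 \<le> Re (sesq W u u)"
  using hermitian_pos_def_inverse[OF Rv] by auto

lemma group_index_less: "j < n \<Longrightarrow> j div d < n div d"
  using d by (metis dvd_div_mult_self less_mult_imp_div_less)

text \<open>Serves twice: with squared moduli for the exponent of the prior, and with second moments
  for its posterior expectation.\<close>

lemma sum_entries_grouped:
  fixes g :: "nat \<times> nat \<Rightarrow> real"
  shows "(\<Sum>x\<in>{..<n} \<times> {..<K}. g x / \<psi> (fst x div d)) =
    (\<Sum>i<n div d. (\<Sum>k<K. \<Sum>j=i*d..<(i+1)*d. g (j, k)) / \<psi> i)"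
proof -
  have "(\<Sum>x\<in>{..<n} \<times> {..<K}. g x / \<psi> (fst x div d)) = (\<Sum>j<n. \<Sum>k<K. g (j, k) / \<psi> (j div d))"
    by (simp add: sum.cartesian_product split_beta)
  also have "\<dots> = (\<Sum>i<n div d. \<Sum>j=i*d..<(i+1)*d. \<Sum>k<K. g (j, k) / \<psi> (j div d))"
    by (rule sum_groups[OF d(2)])
  also have "\<dots> = (\<Sum>i<n div d. (\<Sum>k<K. \<Sum>j=i*d..<(i+1)*d. g (j, k)) / \<psi> i)"
  proof (rule sum.cong[OF refl])
    fix i
    have "j div d = i" if "j \<in> {i*d..<(i+1)*d}" for j
      using that by (intro div_nat_eqI) (auto simp: mult.commute)
    then show "(\<Sum>j=i*d..<(i+1)*d. \<Sum>k<K. g (j, k) / \<psi> (j div d)) =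
        (\<Sum>k<K. \<Sum>j=i*d..<(i+1)*d. g (j, k)) / \<psi> i"
      by (subst sum.swap) (simp add: sum_divide_distrib)
  qed
  finally show ?thesis .
qed

section \<open>The densities as exponentials of quadratic functions\<close>

lemma likelihood_eq:
  "likelihood A Rv Y (mat n K h) = exp (- (K * ln (pi ^ m * Re (det Rv))) - misfit h)"
proof -
  define c where "c = pi ^ m * Re (det Rv)"
  \<comment> \<open>Positivity of the determinant allows the normalizing factor to move into the
    exponent as - ln c.\<close>
  have c: "c > 0" using hermitian_pos_def_det_pos[OF Rv] by (simp add: c_def less_complex_def)
  have "cgauss_density Rv (col (Y - A * mat n K h) k) =
      exp (- ln c - Re (sesq W (resid h k) (resid h k)))" if "k < K" for k
  proof -
    let ?v = "col (Y - A * mat n K h) k"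
    have v: "?v \<in> carrier_vec m" by (rule carrier_vecI) (use A in simp)
    have "(W *\<^sub>v ?v) \<bullet>c ?v = sesq W (resid h k) (resid h k)"
      unfolding cscalar_prod_sesq[OF W(1) v v] using A Y that W(1)
      by (intro sesq_cong) (auto simp: resid_def scalar_prod_def atLeast0LessThan)
    moreover have "exp (- ln c - q) = exp (- q) / c" for q
      using c by (simp add: exp_diff exp_minus field_simps)
    moreover have "dim_row Rv = m" using Rv(1) by simp
    ultimately show ?thesis
      by (simp only: cgauss_density_def c_def)
  qed
  then have "likelihood A Rv Y (mat n K h) = (\<Prod>k<K. exp (- ln c - Re (sesq W (resid h k) (resid h k))))"
    using Y by (simp add: likelihood_def)
  also have "\<dots> = exp (- (K * ln c) - misfit h)"
    by (simp add: exp_sum[symmetric] sum_subtractf misfit_def)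
  finally show ?thesis by (simp add: c_def)
qed

lemma prior_eq:
  assumes "pos \<psi>"
  shows "prior_density d \<psi> (mat n K h) = exp (- (\<Sum>i<n div d. d * K * ln (pi * \<psi> i)) - energy \<psi> h)"
proof -
  have "prior_density d \<psi> (mat n K h) = (\<Prod>i<n div d. \<Prod>k<K.
      exp (- (d * ln (pi * \<psi> i)) - (\<Sum>j=i*d..<(i+1)*d. (cmod (h (j, k)))\<^sup>2) / \<psi> i))"
    unfolding prior_density_def dim_row_mat dim_col_mat
  proof (intro prod.cong refl)
    fix i k assume ik: "i \<in> {..<n div d}" "k \<in> {..<K}"
    have "(i + 1) * d \<le> n div d * d" using ik by (intro mult_le_mono1) auto
    then have le: "(i + 1) * d \<le> n" using d by simp
    have "(\<Sum>j=i*d..<(i+1)*d. (cmod (mat n K h $$ (j, k)))\<^sup>2) = (\<Sum>j=i*d..<(i+1)*d. (cmod (h (j, k)))\<^sup>2)"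
      using ik le by (intro sum.cong) auto
    moreover have "pi * \<psi> i > 0" using assms ik by (simp add: pos_def)
    then have "inverse ((pi * \<psi> i) ^ d) = exp (- (d * ln (pi * \<psi> i)))"
      by (simp add: exp_minus exp_of_nat_mult)
    ultimately show "inverse ((pi * \<psi> i) ^ d) * exp (- (\<Sum>j=i*d..<(i+1)*d. (cmod (mat n K h $$ (j, k)))\<^sup>2) / \<psi> i) =
        exp (- (d * ln (pi * \<psi> i)) - (\<Sum>j=i*d..<(i+1)*d. (cmod (h (j, k)))\<^sup>2) / \<psi> i)"
      by (simp add: mult_exp_exp)
  qed
  also have "\<dots> = exp (- (\<Sum>i<n div d. d * K * ln (pi * \<psi> i)) - energy \<psi> h)"
    unfolding energy_def sum_entries_grouped[of "\<lambda>x. (cmod (h x))\<^sup>2"]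
    by (simp add: exp_sum[symmetric] sum_subtractf sum_negf sum_divide_distrib algebra_simps)
  finally show ?thesis .
qed

lemma joint_eq:
  assumes "pos \<psi>"
  shows "joint \<psi> h = exp (log_const \<psi> - misfit h - energy \<psi> h)"
  unfolding joint_density_def likelihood_eq prior_eq[OF assms] mult_exp_exp
  by (simp add: log_const_def algebra_simps)

section \<open>Measurability, and dependence on a single entry\<close>

lemma measurable_entry [measurable]:
  "x \<in> {..<n} \<times> {..<K} \<Longrightarrow> (\<lambda>h. h x) \<in> borel_measurable L"
  using measurable_component_singleton[of x "{..<n} \<times> {..<K}" "\<lambda>_. lborel :: complex measure"] by simp

lemma measurable_misfit [measurable]: "misfit \<in> borel_measurable L"
proof -
  have r: "(\<lambda>h. resid h k a) \<in> borel_measurable L" if "k < K" for k a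
    unfolding resid_def using that by (intro borel_measurable_diff borel_measurable_sum borel_measurable_times) auto
  have "(\<lambda>h. cnj (resid h k a)) \<in> borel_measurable L" if "k < K" for k a
    by (intro borel_measurable_continuous_on[where f = cnj] continuous_intros r that)
  with r have "(\<lambda>h. sesq W (resid h k) (resid h k)) \<in> borel_measurable L" if "k < K" for k
    unfolding sesq_def using that by (intro borel_measurable_sum borel_measurable_times) auto
  then show ?thesis
    unfolding misfit_def by (intro borel_measurable_sum measurable_compose[OF _ borel_measurable_Re]) auto
qed

lemma measurable_energy [measurable]: "energy \<psi> \<in> borel_measurable L"
  unfolding energy_def by (intro borel_measurable_sum borel_measurable_divide borel_measurable_power) auto

lemma misfit_nonneg: "0 \<le> misfit h"
  unfolding misfit_def by (intro sum_nonneg W)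

text \<open>Only column k of the residual depends on entry (j, k), and it does so affinely with
  column j of A as slope; \<open>sesq_quadratic_expansion\<close> then gives the linear and
  quadratic coefficients.\<close>

lemma misfit_update:
  assumes jk: "j < n" "k < K"
  shows "misfit (h((j, k) := z)) = misfit (h((j, k) := 0)) +
    2 * Re (cnj z * - sesq W (resid (h((j, k) := 0)) k) (\<lambda>a. A $$ (a, j))) +
    Re (sesq W (\<lambda>a. A $$ (a, j)) (\<lambda>a. A $$ (a, j))) * (cmod z)\<^sup>2"
proof -
  define r where "r = resid (h((j, k) := 0)) k"
  have "(\<Sum>l<n. A $$ (a, l) * (h((j, k) := z)) (l, k)) =
      A $$ (a, j) * z + (\<Sum>l\<in>{..<n} - {j}. A $$ (a, l) * h (l, k))" for a z
    using jk by (subst sum.remove[of _ j]) (auto intro!: sum.cong)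
  then have upd: "resid (h((j, k) := z)) k = (\<lambda>a. r a - A $$ (a, j) * z)"
    unfolding r_def resid_def by (simp add: fun_eq_iff del: fun_upd_apply)
  have split: "misfit h' = Re (sesq W (resid h' k) (resid h' k)) +
      (\<Sum>k'\<in>{..<K} - {k}. Re (sesq W (resid h' k') (resid h' k')))" for h'
    unfolding misfit_def using jk by (subst sum.remove[of _ k]) auto
  have same: "resid (h((j, k) := z)) k' = resid (h((j, k) := 0)) k'" if "k' \<noteq> k" for k'
    using that by (simp add: resid_def fun_eq_iff)
  have "(\<Sum>k'\<in>{..<K} - {k}. Re (sesq W (resid (h((j, k) := z)) k') (resid (h((j, k) := z)) k'))) =
      (\<Sum>k'\<in>{..<K} - {k}. Re (sesq W (resid (h((j, k) := 0)) k') (resid (h((j, k) := 0)) k')))"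
  proof (rule sum.cong[OF refl])
    fix k' assume "k' \<in> {..<K} - {k}"
    then have "k' \<noteq> k" by simp
    from same[OF this] show "Re (sesq W (resid (h((j, k) := z)) k') (resid (h((j, k) := z)) k')) =
        Re (sesq W (resid (h((j, k) := 0)) k') (resid (h((j, k) := 0)) k'))" by (rule arg_cong)
  qed
  moreover have "Re (sesq W (resid (h((j, k) := z)) k) (resid (h((j, k) := z)) k)) =
      Re (sesq W r r) + 2 * Re (cnj z * - sesq W r (\<lambda>a. A $$ (a, j))) +
      Re (sesq W (\<lambda>a. A $$ (a, j)) (\<lambda>a. A $$ (a, j))) * (cmod z)\<^sup>2"
    unfolding upd by (rule sesq_quadratic_expansion[OF W(1,2)])
  ultimately show ?thesis
    using split[of "h((j, k) := z)"] split[of "h((j, k) := 0)"] unfolding r_def by linarith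
qed

lemma energy_update:
  assumes jk: "j < n" "k < K"
  shows "energy \<psi> (h((j, k) := z)) = energy \<psi> (h((j, k) := 0)) + (cmod z)\<^sup>2 / \<psi> (j div d)"
proof -
  have "energy \<psi> (h((j, k) := z)) = (cmod z)\<^sup>2 / \<psi> (j div d) +
      (\<Sum>x\<in>{..<n} \<times> {..<K} - {(j, k)}. (cmod (h x))\<^sup>2 / \<psi> (fst x div d))" for z
    unfolding energy_def using jk by (subst sum.remove[of _ "(j, k)"]) (auto intro!: sum.cong)
  from this[of z] this[of 0] show ?thesis by simp
qed

text \<open>Used with B = A for the precision matrix and with B = Y for the right-hand side of the
  mean equation, it expresses both by the forms occurring in \<open>misfit_update\<close>.\<close>

lemma gram_index:
  assumes B: "B \<in> carrier_mat m q" and ij: "i < n" "k < q"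
  shows "(mat_adjoint A * W * B) $$ (i, k) = sesq W (\<lambda>a. B $$ (a, k)) (\<lambda>a. A $$ (a, i))"
proof -
  have "(mat_adjoint A * W * B) $$ (i, k) = (\<Sum>b<m. (\<Sum>a<m. cnj (A $$ (a, i)) * W $$ (a, b)) * B $$ (b, k))"
    using assms A W(1) by (simp add: scalar_prod_def atLeast0LessThan)
  also have "\<dots> = (\<Sum>a<m. \<Sum>b<m. W $$ (a, b) * B $$ (b, k) * cnj (A $$ (a, i)))"
    by (subst sum.swap) (simp add: sum_distrib_left sum_distrib_right mult_ac)
  finally show ?thesis using W(1) by (simp add: sesq_def)
qed

section \<open>The posterior for fixed positive hyperparameters\<close>

context
  fixes \<psi> :: "nat \<Rightarrow> real" assumes \<psi>: "pos \<psi>"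
begin

lemma exp_energy_prod:
  "exp (- energy \<psi> h) = (\<Prod>x\<in>{..<n} \<times> {..<K}. exp (- (inverse (\<psi> (fst x div d)) * (cmod (h x))\<^sup>2)))"
  by (simp add: energy_def exp_sum[symmetric] sum_negf[symmetric] field_simps)

lemma inverse_pos: "x \<in> {..<n} \<times> {..<K} \<Longrightarrow> 0 < inverse (\<psi> (fst x div d))"
  using \<psi> group_index_less by (auto simp: pos_def)

lemma integrable_exp_energy: "integrable L (\<lambda>h. exp (- energy \<psi> h))"
proof -
  interpret product_sigma_finite "\<lambda>_::nat \<times> nat. lborel :: complex measure" ..
  show ?thesis
    unfolding exp_energy_prod using complex_gaussian_moments(1)[OF inverse_pos]
    by (intro product_integrable_prod) (auto simp: has_bochner_integral_iff)
qed

text \<open>A witness that L is not the null measure, on which \<open>evidence_pos\<close>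
  rests.\<close>

lemma integral_exp_energy: "(\<integral>h. exp (- energy \<psi> h) \<partial>L) \<noteq> 0"
proof -
  interpret product_sigma_finite "\<lambda>_::nat \<times> nat. lborel :: complex measure" ..
  have "(\<integral>h. exp (- energy \<psi> h) \<partial>L) = (\<Prod>x\<in>{..<n} \<times> {..<K}. pi / inverse (\<psi> (fst x div d)))"
    unfolding exp_energy_prod using complex_gaussian_moments(1)[OF inverse_pos]
    by (subst product_integral_prod) (auto simp: has_bochner_integral_iff intro!: prod.cong)
  also have "\<dots> \<noteq> 0" using inverse_pos by (fastforce simp: prod_zero_iff)
  finally show ?thesis .
qed

lemma integrable_square_exp_energy:
  assumes x: "x \<in> {..<n} \<times> {..<K}"
  shows "integrable L (\<lambda>h. (cmod (h x))\<^sup>2 * exp (- energy \<psi> h))"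
proof -
  interpret product_sigma_finite "\<lambda>_::nat \<times> nat. lborel :: complex measure" ..
  \<comment> \<open>The factor \<open>(cmod z)\<^sup>2\<close> is inserted at the single coordinate
    x, so the integrand remains a product over the entries.\<close>
  define F where "F y z = (if y = x then (cmod z)\<^sup>2 else 1) *
      exp (- (inverse (\<psi> (fst y div d)) * (cmod z)\<^sup>2))" for y z
  have "integrable lborel (F y)" if "y \<in> {..<n} \<times> {..<K}" for y
    using complex_gaussian_moments(1,2)[OF inverse_pos[OF that]]
    by (cases "y = x") (auto simp: F_def[abs_def] has_bochner_integral_iff)
  then have "integrable L (\<lambda>h. \<Prod>y\<in>{..<n} \<times> {..<K}. F y (h y))"
    by (intro product_integrable_prod) auto
  moreover have "(\<Prod>y\<in>{..<n} \<times> {..<K}. F y (h y)) = (cmod (h x))\<^sup>2 * exp (- energy \<psi> h)" for h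
    unfolding exp_energy_prod F_def prod.distrib using x by (simp add: prod.delta)
  ultimately show ?thesis by simp
qed

lemma measurable_joint [measurable]: "joint \<psi> \<in> borel_measurable L"
  unfolding joint_eq[OF \<psi>, abs_def] by measurable

text \<open>As the misfit is nonnegative, the prior alone provides integrable majorants.\<close>

lemma integrable_joint_weighted:
  assumes int: "integrable L (\<lambda>h. g h * exp (- energy \<psi> h))"
    and [measurable]: "u \<in> borel_measurable L"
    and le: "\<And>h. \<bar>u h\<bar> * exp (- misfit h) \<le> \<bar>g h\<bar>"
  shows "integrable L (\<lambda>h. joint \<psi> h * u h)"
proof (rule Bochner_Integration.integrable_bound)
  show "integrable L (\<lambda>h. exp (log_const \<psi>) * (g h * exp (- energy \<psi> h)))"
    using int by simp
  have "exp (log_const \<psi>) * exp (- energy \<psi> h) * (\<bar>u h\<bar> * exp (- misfit h)) \<le>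
      exp (log_const \<psi>) * exp (- energy \<psi> h) * \<bar>g h\<bar>" for h
    by (intro mult_left_mono le) simp
  moreover have "joint \<psi> h = exp (log_const \<psi>) * exp (- energy \<psi> h) * exp (- misfit h)" for h
    by (simp add: joint_eq[OF \<psi>] mult_exp_exp)
  ultimately show "AE h in L. norm (joint \<psi> h * u h) \<le> norm (exp (log_const \<psi>) * (g h * exp (- energy \<psi> h)))"
    by (simp add: abs_mult mult_ac)
qed measurable

lemma integrable_joint: "integrable L (joint \<psi>)"
  using integrable_joint_weighted[of "\<lambda>_. 1" "\<lambda>_. 1"] integrable_exp_energy misfit_nonneg by simp

lemma integrable_joint_square:
  assumes "x \<in> {..<n} \<times> {..<K}"
  shows "integrable L (\<lambda>h. joint \<psi> h * (cmod (h x))\<^sup>2)"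
proof (rule integrable_joint_weighted[OF integrable_square_exp_energy[OF assms]])
  have [measurable]: "(\<lambda>h. h x) \<in> borel_measurable L" by (rule measurable_entry[OF assms])
  show "(\<lambda>h. (cmod (h x))\<^sup>2) \<in> borel_measurable L" by measurable
  show "\<bar>(cmod (h x))\<^sup>2\<bar> * exp (- misfit h) \<le> \<bar>(cmod (h x))\<^sup>2\<bar>" for h
    using misfit_nonneg by (simp add: mult_left_le)
qed

text \<open>The likelihood absorbs the misfit: t * exp (- t) <= 1 for t >= 0, which leaves the
  integrable prior weight.\<close>

lemma integrable_joint_misfit: "integrable L (\<lambda>h. joint \<psi> h * misfit h)"
proof (rule integrable_joint_weighted[where g = "\<lambda>_. 1"])
  show "\<bar>misfit h\<bar> * exp (- misfit h) \<le> \<bar>1\<bar>" for h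
  proof -
    have "misfit h \<le> exp (misfit h)" using exp_ge_add_one_self[of "misfit h"] by linarith
    then show ?thesis using misfit_nonneg[of h] by (simp add: exp_minus field_simps)
  qed
qed (use integrable_exp_energy in auto)

lemma evidence_eq: "evidence A Rv d \<psi> Y = (\<integral>h. joint \<psi> h \<partial>L)"
  using A Y by (simp add: evidence_def lborel_entries_def)

lemma joint_pos: "0 < joint \<psi> h"
  by (simp add: joint_eq[OF \<psi>])

lemma evidence_pos: "0 < evidence A Rv d \<psi> Y"
proof (rule ccontr)
  assume "\<not> 0 < evidence A Rv d \<psi> Y"
  moreover have "0 \<le> evidence A Rv d \<psi> Y"
    unfolding evidence_eq by (intro Bochner_Integration.integral_nonneg less_imp_le joint_pos)
  ultimately have zero: "(\<integral>h. joint \<psi> h \<partial>L) = 0" by (simp add: evidence_eq)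
  have "AE h in L. joint \<psi> h = 0"
    by (rule integral_nonneg_eq_0_iff_AE[THEN iffD1, OF integrable_joint _ zero])
      (simp add: less_imp_le joint_pos)
  \<comment> \<open>The joint density is positive everywhere; if it vanished almost everywhere,
    every property would hold almost everywhere.\<close>
  then have "AE h in L. exp (- energy \<psi> h) = 0"
  proof eventually_elim
    case (elim h)
    with joint_pos[of h] show ?case by linarith
  qed
  then have "(\<integral>h. exp (- energy \<psi> h) \<partial>L) = (\<integral>h. 0 \<partial>L)"
    by (intro integral_cong_AE) auto
  then show False using integral_exp_energy by simp
qed

definition post :: "(nat \<times> nat \<Rightarrow> complex) \<Rightarrow> real" where
  "post h = joint \<psi> h / evidence A Rv d \<psi> Y"

lemma post_nonneg: "0 \<le> post h"
  using joint_pos evidence_pos by (simp add: post_def less_imp_le)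

lemma measurable_post [measurable]: "post \<in> borel_measurable L"
  unfolding post_def[abs_def] by measurable

lemma posterior_eq: "posterior A Rv d \<psi> Y = density L (\<lambda>h. ennreal (post h))"
  using A Y by (simp add: posterior_def lborel_entries_def post_def)

lemma integrable_post:
  "integrable L post"
  "integrable L (\<lambda>h. post h * misfit h)"
  "x \<in> {..<n} \<times> {..<K} \<Longrightarrow> integrable L (\<lambda>h. post h * (cmod (h x))\<^sup>2)"
  using integrable_divide[OF integrable_joint, of "evidence A Rv d \<psi> Y"]
    integrable_divide[OF integrable_joint_misfit, of "evidence A Rv d \<psi> Y"]
    integrable_divide[OF integrable_joint_square, of x "evidence A Rv d \<psi> Y"]
  by (simp_all add: post_def[abs_def])

lemma integral_post: "(\<integral>h. post h \<partial>L) = 1"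
  using evidence_pos unfolding post_def by (simp add: evidence_eq)

lemma prob_space_posterior: "prob_space (posterior A Rv d \<psi> Y)"
proof
  have "emeasure (posterior A Rv d \<psi> Y) (space (posterior A Rv d \<psi> Y)) = (\<integral>\<^sup>+h. ennreal (post h) \<partial>L)"
    unfolding posterior_eq by (simp add: emeasure_density cong: nn_integral_cong)
  also have "\<dots> = 1"
    using nn_integral_eq_integral[OF integrable_post(1)] post_nonneg integral_post by simp
  finally show "emeasure (posterior A Rv d \<psi> Y) (space (posterior A Rv d \<psi> Y)) = 1" .
qed

abbreviation sq_moment :: "nat \<times> nat \<Rightarrow> real" where
  "sq_moment x \<equiv> (\<integral>h. post h * (cmod (h x))\<^sup>2 \<partial>L)"

text \<open>The expected misfit is taken under \<psi> only, so \<psi>' enters through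
  \<open>log_const\<close> and the weights of the second moments. Integrability is recorded because
  a non-integrable function has Bochner integral 0 by convention.\<close>

lemma expected_log_joint:
  assumes \<psi>': "pos \<psi>'"
  shows "integrable (posterior A Rv d \<psi> Y) (\<lambda>h. ln (joint \<psi>' h))"
    and "em_objective A Rv d Y \<psi> \<psi>' = log_const \<psi>' - (\<integral>h. post h * misfit h \<partial>L) -
      (\<Sum>x\<in>{..<n} \<times> {..<K}. sq_moment x / \<psi>' (fst x div d))"
proof -
  have eq: "post h *\<^sub>R ln (joint \<psi>' h) = log_const \<psi>' * post h - post h * misfit h -
      (\<Sum>x\<in>{..<n} \<times> {..<K}. post h * (cmod (h x))\<^sup>2 / \<psi>' (fst x div d))" for h
    by (simp add: joint_eq[OF \<psi>'] energy_def sum_distrib_left algebra_simps)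
  have [measurable]: "(\<lambda>h. ln (joint \<psi>' h)) \<in> borel_measurable L"
    by (simp add: joint_eq[OF \<psi>'])
  have "integrable L (\<lambda>h. post h *\<^sub>R ln (joint \<psi>' h))"
    unfolding eq using integrable_post
    by (intro Bochner_Integration.integrable_diff Bochner_Integration.integrable_sum integrable_divide
        integrable_mult_right) auto
  then show "integrable (posterior A Rv d \<psi> Y) (\<lambda>h. ln (joint \<psi>' h))"
    unfolding posterior_eq using post_nonneg by (subst integrable_density) auto
  have "em_objective A Rv d Y \<psi> \<psi>' = (\<integral>h. post h *\<^sub>R ln (joint \<psi>' h) \<partial>L)"
    unfolding em_objective_def posterior_eq using post_nonneg A Y by (subst integral_density) auto
  also have "\<dots> = log_const \<psi>' - (\<integral>h. post h * misfit h \<partial>L) -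
      (\<Sum>x\<in>{..<n} \<times> {..<K}. sq_moment x / \<psi>' (fst x div d))"
  proof -
    have s: "integrable L (\<lambda>h. \<Sum>x\<in>{..<n} \<times> {..<K}. post h * (cmod (h x))\<^sup>2 / \<psi>' (fst x div d))"
      using integrable_post by (intro Bochner_Integration.integrable_sum integrable_divide) auto
    have "(\<integral>h. (\<Sum>x\<in>{..<n} \<times> {..<K}. post h * (cmod (h x))\<^sup>2 / \<psi>' (fst x div d)) \<partial>L) =
        (\<Sum>x\<in>{..<n} \<times> {..<K}. sq_moment x / \<psi>' (fst x div d))"
      using integrable_post(3) by (subst Bochner_Integration.integral_sum) auto
    then show ?thesis
      unfolding eq using s integrable_post(1,2) by (simp add: integral_post)
  qed
  finally show "em_objective A Rv d Y \<psi> \<psi>' = log_const \<psi>' - (\<integral>h. post h * misfit h \<partial>L) -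
      (\<Sum>x\<in>{..<n} \<times> {..<K}. sq_moment x / \<psi>' (fst x div d))" .
qed

text \<open>\<open>gaussian_second_moment\<close> applied to \<open>post\<close>: P is the posterior
  precision matrix, b the right-hand side of the equation for the mean, and p j the curvature of the
  exponent along an entry of row j.\<close>

lemma posterior_second_moment:
  assumes jk: "j < n" "k < K"
  shows "of_real (sq_moment (j, k)) =
      of_real ((cmod (posterior_mean A Rv d \<psi> Y $$ (j, k)))\<^sup>2) + posterior_cov A Rv d \<psi> $$ (j, j)"
    and "0 < sq_moment (j, k)"
proof -
  define P where "P = mat_adjoint A * W * A + mat_inv (hyper_mat (n div d) d \<psi>)"
  define b where "b = mat_adjoint A * W * Y"
  define p where "p j = Re (sesq W (\<lambda>a. A $$ (a, j)) (\<lambda>a. A $$ (a, j))) + inverse (\<psi> (j div d))" for j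
  have adj: "mat_adjoint A \<in> carrier_mat n m" using A by auto
  have hyp: "mat_inv (hyper_mat (n div d) d \<psi>) = mat_diag n (\<lambda>j. inverse (complex_of_real (\<psi> (j div d))))"
    using \<psi> d by (intro hyper_mat_inverse) (auto simp: pos_def)
  have P: "P \<in> carrier_mat n n" using A W(1) adj by (auto simp: P_def hyp)
  have b: "b \<in> carrier_mat n K" using Y W(1) adj by (auto simp: b_def)
  have Pi: "P $$ (j, l) = sesq W (\<lambda>a. A $$ (a, l)) (\<lambda>a. A $$ (a, j)) +
      (if j = l then inverse (complex_of_real (\<psi> (j div d))) else 0)" if "j < n" "l < n" for j l
    using that A W(1) gram_index[OF A that] by (auto simp: P_def hyp mat_diag_def)
  have ppos: "p j > 0" if "j < n" for j
    using inverse_pos[of "(j, 0)"] that K W(3) by (auto simp: p_def intro: add_nonneg_pos)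
  have Pp: "P $$ (j, j) = of_real (p j)" if "j < n" for j
    using arg_cong[OF sesq_hermitian[OF W(1,2), of "\<lambda>a. A $$ (a, j)" "\<lambda>a. A $$ (a, j)"], of Im]
    by (simp add: Pi[OF that that] p_def complex_eq_iff)
  \<comment> \<open>With entry (j, k) set to 0 the diagonal prior part of P contributes nothing to
    row j, so what remains is the linear coefficient in \<open>misfit_update\<close>.\<close>
  have G: "(\<Sum>l<n. P $$ (j, l) * (h((j, k) := 0)) (l, k)) - b $$ (j, k) =
      - sesq W (resid (h((j, k) := 0)) k) (\<lambda>a. A $$ (a, j))" if "j < n" "k < K" for j k h
  proof -
    let ?h = "h((j, k) := 0)"
    have "(\<Sum>l<n. P $$ (j, l) * ?h (l, k)) =
        (\<Sum>l<n. sesq W (\<lambda>a. A $$ (a, l)) (\<lambda>a. A $$ (a, j)) * ?h (l, k))"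
      using that by (intro sum.cong) (auto simp: Pi)
    also have "\<dots> - b $$ (j, k) = - sesq W (resid ?h k) (\<lambda>a. A $$ (a, j))"
      using gram_index[OF Y that] unfolding b_def resid_def[abs_def] sesq_diff_left sesq_sum_left sesq_mult_left
      by (simp del: fun_upd_apply)
    finally show ?thesis .
  qed
  have f: "post (h((j, k) := z)) = post (h((j, k) := 0)) * exp (- (2 * Re (cnj z *
      ((\<Sum>l<n. P $$ (j, l) * (h((j, k) := 0)) (l, k)) - b $$ (j, k))) + p j * (cmod z)\<^sup>2))"
    if "j < n" "k < K" for j k h z
    unfolding post_def G[OF that] joint_eq[OF \<psi>] misfit_update[OF that, of _ z] energy_update[OF that, of _ _ z]
      times_divide_eq_left mult_exp_exp p_def
    by (intro arg_cong2[where f = "(/)"] arg_cong[where f = exp]) (simp_all add: field_simps del: fun_upd_apply)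
  have cov: "posterior_cov A Rv d \<psi> = mat_inv P"
    using A by (simp add: posterior_cov_def P_def)
  note moment = gaussian_second_moment[OF P b ppos Pp f post_nonneg integrable_post(1) integral_post
      integrable_post(3) jk]
  \<comment> \<open>Reassociation uses that \<open>mat_inv P\<close> has the right dimensions, which
    the moment lemma supplies together with invertibility.\<close>
  have "mat_inv P * mat_adjoint A * W * Y = mat_inv P * (mat_adjoint A * W) * Y"
    by (simp only: assoc_mult_mat[OF moment(3) adj W(1)])
  also have "\<dots> = mat_inv P * b"
    unfolding b_def by (rule assoc_mult_mat[OF moment(3) mult_carrier_mat[OF adj W(1)] Y])
  finally have mean: "posterior_mean A Rv d \<psi> Y = mat_inv P * b"
    by (simp add: posterior_mean_def cov)
  show "of_real (sq_moment (j, k)) =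
      of_real ((cmod (posterior_mean A Rv d \<psi> Y $$ (j, k)))\<^sup>2) + posterior_cov A Rv d \<psi> $$ (j, j)"
    unfolding cov mean using moment(1) by (simp only:)
  show "0 < sq_moment (j, k)" using moment(2) by (simp only:)
qed

end

section \<open>Group moments and the maximizer\<close>

lemma group_entry_less:
  assumes "i < n div d" "j \<in> {i*d..<(i+1)*d}"
  shows "j < n"
proof -
  have "(i + 1) * d \<le> n div d * d" using assms by (intro mult_le_mono1) auto
  then have "(i + 1) * d \<le> n" using d by simp
  with assms(2) show ?thesis by simp
qed

definition group_moment :: "(nat \<Rightarrow> real) \<Rightarrow> nat \<Rightarrow> real" where
  "group_moment \<psi> i = (\<Sum>k<K. \<Sum>j=i*d..<(i+1)*d. sq_moment \<psi> (j, k))"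

text \<open>This places the candidate maximizer inside the open domain.\<close>

lemma group_moment_pos:
  assumes \<psi>: "pos \<psi>" and i: "i < n div d"
  shows "0 < group_moment \<psi> i"
proof -
  have inner: "0 < (\<Sum>j=i*d..<(i+1)*d. sq_moment \<psi> (j, k))" if "k < K" for k
    using d(1) posterior_second_moment(2)[OF \<psi> group_entry_less[OF i] that]
    by (intro sum_pos) simp_all
  show ?thesis
    unfolding group_moment_def
  proof (rule sum_pos)
    show "0 < (\<Sum>j=i*d..<(i+1)*d. sq_moment \<psi> (j, k))" if "k \<in> {..<K}" for k
      using that by (intro inner) simp
  qed (use K in auto)
qed

text \<open>The instance c = d * K, q = pi of \<open>is_arg_max_log_inverse_sum\<close>; the noise
  determinant and the expected misfit form the constant B. Values of \<psi>' beyond the last group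
  are free, so the maximizer is unique up to these.\<close>

lemma is_arg_max_em_objective:
  assumes \<psi>: "pos \<psi>"
  shows "is_arg_max (em_objective A Rv d Y \<psi>) (\<lambda>\<psi>'. \<forall>i<n div d. \<psi>' i > 0) \<psi>' \<longleftrightarrow>
    (\<forall>i<n div d. \<psi>' i = group_moment \<psi> i / (d * K))"
proof (rule is_arg_max_log_inverse_sum[where q = pi])
  fix \<psi>' :: "nat \<Rightarrow> real" assume "\<forall>i<n div d. \<psi>' i > 0"
  then have \<psi>': "pos \<psi>'" by (simp add: pos_def)
  have "(\<Sum>x\<in>{..<n} \<times> {..<K}. sq_moment \<psi> x / \<psi>' (fst x div d)) =
      (\<Sum>i<n div d. group_moment \<psi> i / \<psi>' i)"
    unfolding group_moment_def by (rule sum_entries_grouped)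
  then show "em_objective A Rv d Y \<psi> \<psi>' =
      (- (K * ln (pi ^ m * Re (det Rv))) - (\<integral>h. post \<psi> h * misfit h \<partial>L)) -
      (\<Sum>i<n div d. real (d * K) * ln (pi * \<psi>' i) + group_moment \<psi> i / \<psi>' i)"
    unfolding expected_log_joint(2)[OF \<psi> \<psi>'] log_const_def sum.distrib by linarith
qed (use K d(1) group_moment_pos[OF \<psi>] in simp_all)

text \<open>Stated over the complex numbers because the posterior covariance is a complex matrix;
  that its diagonal sum over a group is real is part of the conclusion.\<close>

lemma group_moment_eq:
  assumes \<psi>: "pos \<psi>" and i: "i < n div d"
  shows "complex_of_real (group_moment \<psi> i / (d * K)) =
    1 / of_nat (d * K) * (\<Sum>k<K. \<Sum>j=i*d..<(i+1)*d.
      complex_of_real ((cmod (posterior_mean A Rv d \<psi> Y $$ (j, k)))\<^sup>2)) +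
    1 / of_nat d * (\<Sum>j=i*d..<(i+1)*d. posterior_cov A Rv d \<psi> $$ (j, j))"
    (is "_ = 1 / _ * ?S + 1 / _ * ?T")
proof -
  have "complex_of_real (group_moment \<psi> i) = (\<Sum>k<K. \<Sum>j=i*d..<(i+1)*d.
      complex_of_real ((cmod (posterior_mean A Rv d \<psi> Y $$ (j, k)))\<^sup>2) + posterior_cov A Rv d \<psi> $$ (j, j))"
    unfolding group_moment_def of_real_sum
  proof (intro sum.cong refl)
    fix k j assume "k \<in> {..<K}" "j \<in> {i*d..<(i+1)*d}"
    then show "complex_of_real (sq_moment \<psi> (j, k)) =
        complex_of_real ((cmod (posterior_mean A Rv d \<psi> Y $$ (j, k)))\<^sup>2) + posterior_cov A Rv d \<psi> $$ (j, j)"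
      using posterior_second_moment(1)[OF \<psi> group_entry_less[OF i]] by simp
  qed
  \<comment> \<open>The covariance term is the same for all K columns, which is why its final weight
    is 1 / d rather than 1 / (d K).\<close>
  also have "\<dots> = ?S + of_nat K * ?T"
    by (simp only: sum.distrib sum_constant card_lessThan)
  finally have eq: "complex_of_real (group_moment \<psi> i) = ?S + of_nat K * ?T" .
  show ?thesis
    unfolding of_real_divide eq using K d(1) by (simp only: of_nat_mult of_real_mult of_real_of_nat_eq) (simp add: field_simps)
qed

end

text \<open>The first two conjuncts certify the third: they make the objective a genuine
  expectation, rather than an integral against an unnormalized measure or the default value 0 of a
  non-integrable function.\<close>

theorem theorem1:
  fixes N M R K L d :: nat
    and x :: "nat \<Rightarrow> nat \<Rightarrow> complex"
    and Rv Y Xt \<Sigma> \<M> :: "complex mat"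
    and \<psi>prev :: "nat \<Rightarrow> real"
  assumes "N > 0" "M > 0" "R > 0" "K > 0" "L > 0" "d > 0"
    and "d dvd N * M * R"
    and "Rv \<in> carrier_mat (M * (L + R - 1)) (M * (L + R - 1))"
    and "hermitian_pos_def Rv"
    and "Y \<in> carrier_mat (M * (L + R - 1)) K"
    and "\<forall>i<N * M * R div d. \<psi>prev i > 0"
    and "Xt = mimo_mat N M L R x"
    and "\<Sigma> = posterior_cov Xt Rv d \<psi>prev"
    and "\<M> = posterior_mean Xt Rv d \<psi>prev Y"
  shows "prob_space (posterior Xt Rv d \<psi>prev Y) \<and>
    (\<forall>\<psi>. (\<forall>i<N * M * R div d. \<psi> i > 0) \<longrightarrow>
       integrable (posterior Xt Rv d \<psi>prev Y)
         (\<lambda>h. ln (joint_density Xt Rv d \<psi> Y (mat (N * M * R) K h)))) \<and>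
    (\<forall>\<psi>hat.
       is_arg_max (em_objective Xt Rv d Y \<psi>prev) (\<lambda>\<psi>. \<forall>i<N * M * R div d. \<psi> i > 0) \<psi>hat \<longleftrightarrow>
       (\<forall>i<N * M * R div d.
          complex_of_real (\<psi>hat i) =
            1 / of_nat (d * K) *
              (\<Sum>k<K. \<Sum>j=i*d..<(i+1)*d. complex_of_real ((cmod (\<M> $$ (j, k)))\<^sup>2)) +
            1 / of_nat d * (\<Sum>j=i*d..<(i+1)*d. \<Sigma> $$ (j, j))))"
proof -
  have "Xt \<in> carrier_mat (M * (L + R - 1)) (N * M * R)"
    unfolding assms(12) by (rule carrier_matI) (simp_all add: mimo_mat_def kronecker_def waveform_mat_def)
  then interpret model: grouped_linear_gaussian_model Xt Rv Y "M * (L + R - 1)" "N * M * R" K d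
    using assms(4,6-10) by unfold_locales
  have \<psi>prev: "model.pos \<psi>prev"
    using assms(11) by (simp only: model.pos_def)
  note formula = model.group_moment_eq[OF \<psi>prev, folded assms(13,14)]
  show ?thesis
  proof (intro conjI allI impI)
    show "prob_space (posterior Xt Rv d \<psi>prev Y)"
      by (rule model.prob_space_posterior[OF \<psi>prev])
  next
    fix \<psi> :: "nat \<Rightarrow> real" assume "\<forall>i<N * M * R div d. \<psi> i > 0"
    then show "integrable (posterior Xt Rv d \<psi>prev Y) (\<lambda>h. ln (joint_density Xt Rv d \<psi> Y (mat (N * M * R) K h)))"
      by (intro model.expected_log_joint(1)[OF \<psi>prev]) (simp only: model.pos_def)
  next
    fix \<psi>hat :: "nat \<Rightarrow> real"
    show "is_arg_max (em_objective Xt Rv d Y \<psi>prev) (\<lambda>\<psi>. \<forall>i<N * M * R div d. \<psi> i > 0) \<psi>hat \<longleftrightarrow>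
       (\<forall>i<N * M * R div d.
          complex_of_real (\<psi>hat i) =
            1 / of_nat (d * K) *
              (\<Sum>k<K. \<Sum>j=i*d..<(i+1)*d. complex_of_real ((cmod (\<M> $$ (j, k)))\<^sup>2)) +
            1 / of_nat d * (\<Sum>j=i*d..<(i+1)*d. \<Sigma> $$ (j, j)))"
      unfolding model.is_arg_max_em_objective[OF \<psi>prev]
      by (intro all_cong1 imp_cong refl) (simp only: formula[symmetric] of_real_eq_iff)
  qed
qed

end
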